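(* Let $E$ be an interval of type (i), (ii) or (iii) and let $f\in L^{1,+}_{\mathrm{loc}}(E)$ be admissible (in dimension $d$), i.e. (F1) $(\mathrm{I}^{\frac d2+1}f)(t)<\infty$ for all $t\in E$, and (F2) if $E=(-\infty,b)$ is of type (ii), there exist $\varepsilon>0$ and $n_0\in\mathbb{N}$ such that $(\mathrm{I}^{\frac d2+1}f)(b-1/n)\ge n^{\varepsilon}$ for all $n\ge n_0$. Then for every $\gamma\in(0,\infty)$ the Laguerre diagram $\mathcal{L}_d(\eta_{f,\gamma})$ is almost surely a normal tessellation of $\mathbb{R}^d$ (i.e. $\mathcal{L}_{d,\gamma}(f)$ is a normal random tessellation).
   Context: Interval types: (i) $E=[a,\infty)$, $a\in\mathbb{R}$; (ii) $E=(-\infty,b)$, $b\in\mathbb{R}$; (iii) $E=\mathbb{R}$. $L^{1,+}_{\mathrm{loc}}(E)$: non-negative measurable functions on $\operatorname{int}E$ integrable on compact subsets of $E$, extended by $0$ outside their domain. $(\mathrm{I}^{\alpha}f)(x)=\frac{1}{\Gamma(\alpha)}\int_{-\infty}^{x}f(t)(x-t)^{\alpha-1}dt$. $\eta_{f,\gamma}$ is a Poisson point process on $\mathbb{R}^d\times E$ with intensity measure $\gamma f(h)\,dh\,dv$. Power function: $\mathrm{pow}(w,(v,h))=\|w-v\|^2+h$ for $w,v\in\mathbb{R}^d$, $h\in\mathbb{R}$. For a countable set $A\subset\mathbb{R}^d\times\mathbb{R}$ and $(v,h)\in A$ the Laguerre cell is $C((v,h),A)=\{w\in\mathbb{R}^d:\mathrm{pow}(w,(v,h))\le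 \mathrm{pow}(w,(v',h'))\ \forall (v',h')\in A\}$, and the Laguerre diagram $\mathcal{L}_d(A)$ is the collection of all Laguerre cells with non-empty interior. A tessellation of $\mathbb{R}^d$ is a locally finite family of convex polytopes covering $\mathbb{R}^d$ with non-empty pairwise disjoint interiors; it is face-to-face if the intersection of any two cells is empty or a common face of both; a face-to-face tessellation is normal if each $k$-dimensional face, $k\in\{0,\dots,d-1\}$, lies in exactly $d+1-k$ cells. $\mathcal{L}_{d,\gamma}(f):=\mathcal{L}_d(\eta_{f,\gamma})$.
   Formalization: The formal theorem additionally assumes that f is not almost everywhere zero on E; for f = 0 (possible for types (i) and (iii)) the Poisson process and hence the Laguerre diagram are empty, so the claim as stated fails. *)

theory Defs
  imports "HOL-Probability.Probability"
begin

definition pcount :: "'b set \<Rightarrow> 'b set \<Rightarrow> enat" where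
  "pcount A B = (if finite (A \<inter> B) then enat (card (A \<inter> B)) else \<infinity>)"

section \<open>Poisson point processes (simple, represented as random sets of points)\<close>

definition poisson_process :: "'a measure \<Rightarrow> ('a \<Rightarrow> 'b set) \<Rightarrow> 'b measure \<Rightarrow> bool" where
  "poisson_process M eta Lam \<longleftrightarrow>
     prob_space M \<and>
     (\<forall>B \<in> sets Lam.
        (\<lambda>\<omega>. pcount (eta \<omega>) B) \<in> measurable M (count_space UNIV) \<and>
        (emeasure Lam B < \<infinity> \<longrightarrow>
           (\<forall>k::nat. measure M {\<omega> \<in> space M. pcount (eta \<omega>) B = enat k}
              = exp (- enn2real (emeasure Lam B)) * enn2real (emeasure Lam B) ^ k / fact k)) \<and>
        (emeasure Lam B = \<infinity> \<longrightarrow> (AE \<omega> in M. pcount (eta \<omega>) B = \<infinity>))) \<and>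
     (\<forall>(I::nat set) B. finite I \<longrightarrow> (\<forall>i\<in>I. B i \<in> sets Lam) \<longrightarrow> disjoint_family_on B I \<longrightarrow>
        prob_space.indep_vars M (\<lambda>_. count_space UNIV) (\<lambda>i \<omega>. pcount (eta \<omega>) (B i)) I)"

definition intensity :: "real \<Rightarrow> (real \<Rightarrow> real) \<Rightarrow> ((real^'d) \<times> real) measure" where
  "intensity \<gamma> f = density lborel (\<lambda>p. ennreal (\<gamma> * f (snd p)))"

definition RL_integral :: "real \<Rightarrow> (real \<Rightarrow> real) \<Rightarrow> real \<Rightarrow> ennreal" where
  "RL_integral \<alpha> f x =
     (\<integral>\<^sup>+ t. ennreal (f t * (x - t) powr (\<alpha> - 1) / Gamma \<alpha>) * indicator {..<x} t \<partial>lborel)"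

definition L1_loc_plus :: "real set \<Rightarrow> (real \<Rightarrow> real) \<Rightarrow> bool" where
  "L1_loc_plus E f \<longleftrightarrow>
     f \<in> borel_measurable lborel \<and> (\<forall>h. 0 \<le> f h) \<and> (\<forall>h. h \<notin> interior E \<longrightarrow> f h = 0) \<and>
     (\<forall>K. compact K \<and> K \<subseteq> E \<longrightarrow> set_integrable lborel K f)"

definition admissible :: "nat \<Rightarrow> real set \<Rightarrow> (real \<Rightarrow> real) \<Rightarrow> bool" where
  "admissible d E f \<longleftrightarrow>
     (\<forall>t\<in>E. RL_integral (real d / 2 + 1) f t < \<infinity>) \<and>
     (\<forall>b. E = {..<b} \<longrightarrow>
        (\<exists>\<epsilon>>0. \<exists>n0::nat. \<forall>n\<ge>n0.
            ennreal (real n powr \<epsilon>) \<le> RL_integral (real d / 2 + 1) f (b - 1 / real n)))"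

definition pow :: "'v::real_normed_vector \<Rightarrow> 'v \<times> real \<Rightarrow> real" where
  "pow w p = (norm (w - fst p))\<^sup>2 + snd p"

definition laguerre_cell :: "'v::real_normed_vector \<times> real \<Rightarrow> ('v \<times> real) set \<Rightarrow> 'v set" where
  "laguerre_cell p A = {w. \<forall>q\<in>A. pow w p \<le> pow w q}"

definition laguerre_diagram :: "('v::real_normed_vector \<times> real) set \<Rightarrow> 'v set set" where
  "laguerre_diagram A = {laguerre_cell p A | p. p \<in> A \<and> interior (laguerre_cell p A) \<noteq> {}}"

definition tessellation :: "'v::euclidean_space set set \<Rightarrow> bool" where
  "tessellation T \<longleftrightarrow>
     (\<forall>C\<in>T. polytope C \<and> interior C \<noteq> {}) \<and>
     \<Union>T = UNIV \<and>
     (\<forall>C\<in>T. \<forall>C'\<in>T. C \<noteq> C' \<longrightarrow> interior C \<inter> interior C' = {}) \<and>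
     (\<forall>K. bounded K \<longrightarrow> finite {C\<in>T. C \<inter> K \<noteq> {}})"

definition face_to_face :: "'v::euclidean_space set set \<Rightarrow> bool" where
  "face_to_face T \<longleftrightarrow> tessellation T \<and>
     (\<forall>C\<in>T. \<forall>C'\<in>T. C \<inter> C' = {} \<or> (C \<inter> C' face_of C \<and> C \<inter> C' face_of C'))"

definition normal_tessellation :: "'v::euclidean_space set set \<Rightarrow> bool" where
  "normal_tessellation T \<longleftrightarrow> face_to_face T \<and>
     (\<forall>C\<in>T. \<forall>F. F face_of C \<and> 0 \<le> aff_dim F \<and> aff_dim F < int DIM('v) \<longrightarrow>
        int (card {C'\<in>T. F \<subseteq> C'}) = int DIM('v) + 1 - aff_dim F)"

end

theory Submission
  imports Defs "HOL-Real_Asymp.Real_Asymp"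
begin

text \<open>
  Lifting a site \<open>(v, h)\<close> to \<open>(1, v, \<parallel>v\<parallel>\<^sup>2 + h)\<close> makes the power function at \<open>w\<close> a linear functional of
  the site. Three properties of the point configuration then force the Laguerre diagram to be a
  normal tessellation: on each ball only finitely many sites compete (local finiteness), sites are
  unbounded in every direction (bounded cells), and any \<open>d + 2\<close> lifted sites are linearly
  independent. By the last one, the differences between the powers of the sites that are minimal at
  a point \<open>w\<close> can be prescribed freely by moving \<open>w\<close>. If \<open>w\<close> lies in the relative interior of a face, the
  face is therefore the intersection of the cells of these sites, and its codimension is one less
  than their number.

  Almost surely a Poisson process has these properties. Far orthants have infinite intensity. The
  points isolated in disjoint sets are independent with absolutely continuous laws, so a lifted point
  misses the span of at most \<open>d + 1\<close> others. Condition (F1) makes the region where the power can be at most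
  \<open>t\<close> somewhere on a ball of finite intensity. When the heights are bounded by \<open>b\<close>, condition (F2)
  makes the probability that the minimal power exceeds \<open>b - 1/n\<close> at some point of a grid with
  \<open>O(n^d)\<close> points at most \<open>O(n^d exp (- c n^\<epsilon>))\<close>, so the minimal power stays away from \<open>b\<close> on each ball.
\<close>

section \<open>Laguerre diagrams of generic configurations\<close>

definition lift :: "'v::euclidean_space \<times> real \<Rightarrow> real \<times> 'v \<times> real" where
  "lift p = (1, fst p, (norm (fst p))\<^sup>2 + snd p)"

lemma inj_lift: "inj lift"
  by (auto simp: inj_def lift_def prod_eq_iff)

lemma pow_eq_inner_lift: "pow w p = ((norm w)\<^sup>2, (-2) *\<^sub>R w, 1) \<bullet> lift p"
  by (simp add: pow_def lift_def power2_norm_eq_inner inner_diff inner_commute algebra_simps)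

text \<open>The quadratic terms in \<open>w\<close> cancel, so comparing two powers is an affine
  condition on \<open>w\<close>. This is what makes cells intersections of half-spaces.\<close>

lemma pow_diff:
  fixes w :: "'v::euclidean_space"
  shows "pow w p - pow w q =
    2 * ((fst q - fst p) \<bullet> w) + ((norm (fst p))\<^sup>2 + snd p - (norm (fst q))\<^sup>2 - snd q)"
  by (simp add: pow_def power2_norm_eq_inner inner_diff inner_commute algebra_simps)

lemma pow_add_diff:
  fixes w :: "'v::euclidean_space"
  shows "pow (w + z) p - pow (w + z) q = pow w p - pow w q + 2 * ((fst q - fst p) \<bullet> z)"
  by (simp add: pow_diff inner_add_right)

lemma continuous_on_pow: "continuous_on S (\<lambda>w. pow w p)"
  unfolding pow_def by (intro continuous_intros)

lemma pow_le_iff_halfspace: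
  fixes w :: "'v::euclidean_space"
  shows "pow w p \<le> pow w q \<longleftrightarrow>
    (2 *\<^sub>R (fst q - fst p)) \<bullet> w \<le> (norm (fst q))\<^sup>2 + snd q - (norm (fst p))\<^sup>2 - snd p"
  unfolding inner_scaleR_left using pow_diff[of w p q] by linarith

lemma pow_eq_iff_hyperplane:
  fixes w :: "'v::euclidean_space"
  shows "pow w p = pow w q \<longleftrightarrow>
    (2 *\<^sub>R (fst q - fst p)) \<bullet> w = (norm (fst q))\<^sup>2 + snd q - (norm (fst p))\<^sup>2 - snd p"
  unfolding inner_scaleR_left using pow_diff[of w p q] by linarith

lemma polyhedron_pow_le: "polyhedron {w::'v::euclidean_space. pow w p \<le> pow w q}"
  unfolding pow_le_iff_halfspace by (rule polyhedron_halfspace_le)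

lemma laguerre_cell_eq_Inter: "laguerre_cell p A = (\<Inter>q\<in>A. {w. pow w p \<le> pow w q})"
  by (auto simp: laguerre_cell_def)

lemma convex_laguerre_cell: "convex (laguerre_cell (p :: 'v::euclidean_space \<times> real) A)"
  unfolding laguerre_cell_eq_Inter
  by (intro convex_INT polyhedron_imp_convex polyhedron_pow_le)

text \<open>Within the cell of \<open>p\<close> the inequality between the powers of
  \<open>p\<close> and \<open>q\<close> describes a half-space containing the cell, and the points
  shared with the cell of \<open>q\<close> are those on its supporting hyperplane.\<close>

lemma laguerre_cell_Int_face_of:
  fixes p q :: "'v::euclidean_space \<times> real"
  assumes "p \<in> A" "q \<in> A"
  shows "laguerre_cell p A \<inter> laguerre_cell q A face_of laguerre_cell p A"
proof -
  have *: "laguerre_cell p A \<inter> laguerre_cell q A = laguerre_cell p A \<inter> {w. pow w p = pow w q}"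
    using assms by (auto simp: laguerre_cell_def intro: antisym)
  show ?thesis
    unfolding * pow_eq_iff_hyperplane
    by (rule face_of_Int_supporting_hyperplane_le[OF convex_laguerre_cell])
       (use assms in \<open>auto simp: laguerre_cell_def pow_le_iff_halfspace\<close>)
qed

lemma small_multiple:
  fixes u :: "'v::real_normed_vector"
  assumes "e > 0"
  obtains s :: real where "s > 0" "s * norm u < e"
proof
  show "e / (norm u + 1) > 0" using assms norm_ge_zero[of u] by (intro divide_pos_pos) linarith+
  show "e / (norm u + 1) * norm u < e"
    using assms norm_ge_zero[of u] by (simp add: field_simps add_pos_nonneg)
qed

text \<open>In \<open>locally_determined\<close> one threshold serves both halves: a site outside
  the finite set has power above \<open>t\<close> on the whole ball, where some site always has
  power at most \<open>t\<close>, so it is never minimal there. In \<open>general_position\<close>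
  the bound \<open>DIM('v) + 2\<close> is the dimension of the space of lifted sites.\<close>

locale generic_sites =
  fixes A :: "('v::euclidean_space \<times> real) set"
  assumes locally_determined: "\<And>R. \<exists>t. finite {p \<in> A. \<exists>w\<in>cball 0 R. pow w p \<le> t} \<and>
      (\<forall>w\<in>cball 0 R. \<exists>p\<in>A. pow w p \<le> t)"
    and spread: "\<And>c. \<exists>Q\<subseteq>A. finite Q \<and> (\<forall>w. \<exists>q\<in>Q. c * norm w \<le> w \<bullet> fst q)"
    and general_position: "\<And>S. S \<subseteq> A \<Longrightarrow> finite S \<Longrightarrow> card S \<le> DIM('v) + 2 \<Longrightarrow> independent (lift ` S)"
begin

section \<open>Minimal sites at a point and the diagram near that point\<close>

definition minimizers :: "'v \<Rightarrow> ('v \<times> real) set" where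
  "minimizers w = {p \<in> A. w \<in> laguerre_cell p A}"

lemma pow_minimizers_eq: "p \<in> minimizers w \<Longrightarrow> q \<in> minimizers w \<Longrightarrow> pow w p = pow w q"
  by (auto simp: minimizers_def laguerre_cell_def intro: antisym)

text \<open>Finitely many sites, and at least one, have power at most \<open>t\<close> at
  \<open>w\<close>. The least power among them is the least power of all, because every other site
  exceeds \<open>t\<close>.\<close>

lemma minimizers_finite_nonempty: "finite (minimizers w) \<and> minimizers w \<noteq> {}"
proof -
  obtain t where fin: "finite {p \<in> A. \<exists>w'\<in>cball 0 (norm w). pow w' p \<le> t}"
    and ex: "\<forall>w'\<in>cball 0 (norm w). \<exists>p\<in>A. pow w' p \<le> t"
    using locally_determined by blast
  define F where "F = {p \<in> A. pow w p \<le> t}"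
  have "finite F" by (rule finite_subset[OF _ fin]) (auto simp: F_def)
  moreover have "F \<noteq> {}" using bspec[OF ex, of w] unfolding F_def by force
  ultimately obtain p where p: "p \<in> F" "\<And>q. q \<in> F \<Longrightarrow> pow w p \<le> pow w q"
    using ex_is_arg_min_if_finite[of F "pow w"] by (auto simp: is_arg_min_linorder)
  have "p \<in> minimizers w"
    using p by (fastforce simp: minimizers_def laguerre_cell_def F_def)
  moreover have "minimizers w \<subseteq> F"
  proof
    fix q assume "q \<in> minimizers w"
    then have "q \<in> A" "pow w q \<le> pow w p"
      using p(1) by (auto simp: minimizers_def laguerre_cell_def F_def)
    then show "q \<in> F" using p(1) by (auto simp: F_def)
  qed
  ultimately show ?thesis using \<open>finite F\<close> finite_subset by blast
qed

lemmas minimizers_finite = minimizers_finite_nonempty[THEN conjunct1]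
  and minimizers_nonempty = minimizers_finite_nonempty[THEN conjunct2]

text \<open>All lifted minimizers lie in a hyperplane through the origin, because the power function
  is a linear functional of the lifted site; this caps their number at \<open>DIM('v) + 1\<close>.\<close>

lemma independent_lift_minimizers: "independent (lift ` minimizers w)"
proof (cases "card (minimizers w) \<le> DIM('v) + 2")
  case True
  then show ?thesis
    using general_position minimizers_finite by (auto simp: minimizers_def)
next
  case False
  then obtain S where S: "S \<subseteq> minimizers w" "card S = DIM('v) + 2" "finite S"
    using obtain_subset_with_card_n[of "DIM('v) + 2" "minimizers w"] by auto
  have indep: "independent (lift ` S)"
    using S by (intro general_position) (auto simp: minimizers_def)
  have card: "card (lift ` S) = DIM('v) + 2"
    using S(2) card_image[OF inj_on_subset[OF inj_lift subset_UNIV]] by metis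
  obtain p0 where p0: "p0 \<in> minimizers w" using minimizers_nonempty by blast
  \<comment> \<open>The first lifted coordinate is constantly 1, so subtracting the common power in
    the first entry turns equality of powers into orthogonality to \<open>z\<close>.\<close>
  define z :: "real \<times> 'v \<times> real" where "z = ((norm w)\<^sup>2 - pow w p0, (-2) *\<^sub>R w, 1)"
  have "z \<bullet> lift p = 0" if "p \<in> minimizers w" for p
    using pow_minimizers_eq[OF that p0] pow_eq_inner_lift[of w p]
    by (simp add: z_def lift_def)
  then have "lift ` S \<subseteq> {x. z \<bullet> x = 0}" using S by auto
  then have "card (lift ` S) \<le> dim {x. z \<bullet> x = 0}"
    using indep independent_card_le_dim by blast
  moreover have "dim {x. z \<bullet> x = 0} = DIM(real \<times> 'v \<times> real) - 1"
    by (rule dim_hyperplane) (simp add: z_def zero_prod_def)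
  ultimately show ?thesis using card by simp
qed

text \<open>Independence allows a linear functional with the values \<open>y\<close> on the lifted
  minimizers. On differences its constant coordinate drops out, and equality of powers at
  \<open>w\<close> expresses its last coordinate through the positions, so the functional acts as an
  inner product with one direction.\<close>

lemma separating_direction:
  obtains u where "\<And>p q. p \<in> minimizers w \<Longrightarrow> q \<in> minimizers w \<Longrightarrow>
    (fst p - fst q) \<bullet> u = y p - y q"
proof -
  define g where "g x = y (inv lift x)" for x
  obtain G where G: "linear G" "\<forall>x\<in>lift ` minimizers w. G x = g x"
    using linear_independent_extend[OF independent_lift_minimizers, of w g] by auto
  have Gy: "lift p \<bullet> adjoint G 1 = y p" if "p \<in> minimizers w" for p
    using that G by (simp add: adjoint_works g_def inv_f_f[OF inj_lift])
  obtain a u b where gaub: "adjoint G 1 = (a, u, b)" by (metis surj_pair)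
  \<comment> \<open>The last lifted coordinates of two minimizers differ by
    \<open>2 * ((fst p - fst q) \<bullet> w)\<close>; this moves the coefficient \<open>b\<close>
    into the direction.\<close>
  have "(fst p - fst q) \<bullet> (u + (2 * b) *\<^sub>R w) = y p - y q"
    if "p \<in> minimizers w" "q \<in> minimizers w" for p q
  proof -
    have "y p - y q = (fst p - fst q) \<bullet> u +
        b * ((norm (fst p))\<^sup>2 + snd p - (norm (fst q))\<^sup>2 - snd q)"
      using Gy[OF that(1)] Gy[OF that(2)] gaub by (simp add: lift_def inner_diff algebra_simps)
    moreover have "(norm (fst p))\<^sup>2 + snd p - (norm (fst q))\<^sup>2 - snd q = 2 * ((fst p - fst q) \<bullet> w)"
      using pow_diff[of w p q] pow_minimizers_eq[OF that] by (simp add: inner_diff)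
    ultimately show ?thesis by (simp add: inner_add_right)
  qed
  then show thesis using that by blast
qed

text \<open>Only finitely many sites can compete near \<open>w\<close>, and the strict inequalities
  that hold at \<open>w\<close> between a minimizer and the other competitors persist on a small
  ball by continuity.\<close>

lemma minimizers_determine_nearby:
  obtains e where "e > 0"
    and "\<And>w' p. w' \<in> ball w e \<Longrightarrow> p \<in> A - minimizers w \<Longrightarrow>
           \<exists>q\<in>minimizers w. pow w' q < pow w' p"
proof -
  obtain t where fin: "finite {p \<in> A. \<exists>w'\<in>cball 0 (norm w + 1). pow w' p \<le> t}" (is "finite ?F")
    and ex: "\<forall>w'\<in>cball 0 (norm w + 1). \<exists>p\<in>A. pow w' p \<le> t"
    using locally_determined by blast
  obtain p0 where p0: "p0 \<in> minimizers w" using minimizers_nonempty by blast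
  \<comment> \<open>Radius 1 keeps the neighbourhood inside the ball of radius
    \<open>norm w + 1\<close> on which \<open>t\<close> is valid.\<close>
  define U where "U = ball w 1 \<inter> (\<Inter>p\<in>?F - minimizers w. {w'. pow w' p0 < pow w' p})"
  have "open U" unfolding U_def
    by (intro open_Int open_ball open_INT finite_Diff[OF fin] ballI open_Collect_less continuous_on_pow)
  moreover have "w \<in> U"
  proof -
    have "pow w p0 < pow w p" if "p \<in> A - minimizers w" for p
      using that p0 by (fastforce simp: minimizers_def laguerre_cell_def)
    then show ?thesis by (auto simp: U_def)
  qed
  ultimately obtain e where e: "e > 0" "ball w e \<subseteq> U" using open_contains_ball by metis
  have "\<exists>q\<in>minimizers w. pow w' q < pow w' p" if w': "w' \<in> ball w e" and p: "p \<in> A - minimizers w" for w' p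
  proof (cases "p \<in> ?F")
    case True
    then have "pow w' p0 < pow w' p" using e(2) w' p unfolding U_def by blast
    then show ?thesis using p0 by blast
  next
    \<comment> \<open>Here \<open>p\<close> has power above \<open>t\<close> on the ball and is
      beaten by some \<open>p'\<close> with power at most \<open>t\<close>. If \<open>p'\<close> is
      no minimizer, it is among the finitely many competitors that \<open>p0\<close> beats.\<close>
    case False
    have "w' \<in> cball 0 (norm w + 1)"
      using e(2) w' norm_triangle_sub[of w' w] by (auto simp: U_def dist_norm norm_minus_commute)
    moreover from this obtain p' where p': "p' \<in> A" "pow w' p' \<le> t" using ex by blast
    ultimately have p'F: "p' \<in> ?F" and less: "pow w' p' < pow w' p" using False p by force+
    show ?thesis
    proof (cases "p' \<in> minimizers w")
      case True
      then show ?thesis using less by blast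
    next
      case False
      then have "pow w' p0 < pow w' p'" using e(2) w' p'F unfolding U_def by blast
      then show ?thesis using p0 less less_trans by blast
    qed
  qed
  with e(1) show thesis using that by blast
qed

text \<open>Every other site is beaten by a minimizer at \<open>w'\<close>, so only the comparisons
  among minimizers remain.\<close>

lemma mem_cell_near:
  assumes near: "\<And>p. p \<in> A - minimizers w \<Longrightarrow> \<exists>q\<in>minimizers w. pow w' q < pow w' p"
    and p: "p \<in> minimizers w"
  shows "w' \<in> laguerre_cell p A \<longleftrightarrow> (\<forall>q\<in>minimizers w. pow w' p \<le> pow w' q)"
proof -
  have "pow w' p \<le> pow w' q" if "\<forall>q\<in>minimizers w. pow w' p \<le> pow w' q" "q \<in> A" for q
    using near[of q] that by (cases "q \<in> minimizers w") (auto intro: less_imp_le le_less_trans)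
  then show ?thesis by (auto simp: laguerre_cell_def minimizers_def)
qed

text \<open>Moving from \<open>w\<close> in a direction that separates \<open>p\<close> from the
  other minimizers makes \<open>p\<close> the strict winner, which is an open condition. Hence the
  diagram still covers the space after cells without interior points are discarded.\<close>

lemma interior_cell_nonempty:
  assumes p: "p \<in> minimizers w"
  shows "interior (laguerre_cell p A) \<noteq> {}"
proof -
  obtain e where e: "e > 0" and near: "\<And>w' p. w' \<in> ball w e \<Longrightarrow> p \<in> A - minimizers w \<Longrightarrow>
           \<exists>q\<in>minimizers w. pow w' q < pow w' p"
    by (rule minimizers_determine_nearby[of w]) blast
  obtain u where u: "\<And>q r. q \<in> minimizers w \<Longrightarrow> r \<in> minimizers w \<Longrightarrow>
    (fst q - fst r) \<bullet> u = (if q = p then 1 else 0) - (if r = p then 1 else 0)"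
    by (rule separating_direction[of w "\<lambda>r. if r = p then 1 else 0"]) blast
  define V where "V = ball w e \<inter> (\<Inter>q\<in>minimizers w - {p}. {w'. pow w' p < pow w' q})"
  have "open V" unfolding V_def
    by (intro open_Int open_ball open_INT finite_Diff minimizers_finite ballI open_Collect_less continuous_on_pow)
  moreover have "V \<subseteq> laguerre_cell p A"
  proof
    fix w' assume w': "w' \<in> V"
    then have "\<forall>q\<in>minimizers w. pow w' p \<le> pow w' q"
      unfolding V_def by (metis (no_types, lifting) DiffI INT_iff Int_iff less_imp_le mem_Collect_eq
          order_refl singletonD)
    then show "w' \<in> laguerre_cell p A"
      using mem_cell_near[OF near p, of w'] w' by (auto simp: V_def)
  qed
  moreover have "V \<noteq> {}"
  proof -
    obtain s where s: "s > 0" "s * norm u < e"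
      by (rule small_multiple[OF e])
    have "pow (w + s *\<^sub>R u) p < pow (w + s *\<^sub>R u) q" if "q \<in> minimizers w - {p}" for q
    proof -
      have "(fst q - fst p) \<bullet> u = -1" using u[of q p] that p by simp
      then show ?thesis
        using pow_add_diff[of w "s *\<^sub>R u" p q] pow_minimizers_eq[OF p, of q] that s by auto
    qed
    then have "w + s *\<^sub>R u \<in> V" using s by (auto simp: V_def dist_norm)
    then show ?thesis by auto
  qed
  ultimately show ?thesis using interior_maximal by blast
qed

text \<open>At a common interior point both sites are minimal, and a small step in the direction
  favouring \<open>p\<close> would leave the cell of \<open>q\<close>.\<close>

lemma interior_cells_disjoint:
  assumes "p \<in> A" "q \<in> A" "p \<noteq> q"
  shows "interior (laguerre_cell p A) \<inter> interior (laguerre_cell q A) = {}"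
proof (rule ccontr)
  assume "\<not> ?thesis"
  then obtain w where w: "w \<in> interior (laguerre_cell p A)" "w \<in> interior (laguerre_cell q A)" by auto
  then have mem: "p \<in> minimizers w" "q \<in> minimizers w"
    using assms interior_subset by (auto simp: minimizers_def)
  obtain u where u: "\<And>q r. q \<in> minimizers w \<Longrightarrow> r \<in> minimizers w \<Longrightarrow>
    (fst q - fst r) \<bullet> u = (if q = p then 1 else 0) - (if r = p then 1 else 0)"
    by (rule separating_direction[of w "\<lambda>r. if r = p then 1 else 0"]) blast
  obtain e where e: "e > 0" "ball w e \<subseteq> laguerre_cell q A"
    using w(2) mem_interior by blast
  obtain s where s: "s > 0" "s * norm u < e"
    by (rule small_multiple[OF e(1)])
  have "w + s *\<^sub>R u \<in> laguerre_cell q A" using e s by (auto simp: dist_norm)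
  then have "pow (w + s *\<^sub>R u) q \<le> pow (w + s *\<^sub>R u) p" using assms by (auto simp: laguerre_cell_def)
  moreover have "(fst q - fst p) \<bullet> u = -1" using u[of q p] mem assms by simp
  ultimately show False
    using pow_add_diff[of w "s *\<^sub>R u" p q] pow_minimizers_eq[OF mem] s by auto
qed

section \<open>Cells as polytopes and the tessellation property\<close>

lemma mem_laguerre_diagram_iff:
  "C \<in> laguerre_diagram A \<longleftrightarrow> (\<exists>p\<in>A. C = laguerre_cell p A \<and> interior C \<noteq> {})"
  by (auto simp: laguerre_diagram_def)

text \<open>For each \<open>w\<close> a site of the finite set \<open>Q\<close> lies so far out in
  the direction of \<open>w\<close> that it beats \<open>p\<close> once \<open>norm w\<close> is
  large.\<close>

lemma bounded_laguerre_cell: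
  assumes "p \<in> A"
  shows "bounded (laguerre_cell p A)"
proof -
  \<comment> \<open>The summand 1 leaves a surplus of \<open>norm w\<close> after Cauchy-Schwarz has
    been applied to \<open>w \<bullet> fst p\<close>.\<close>
  obtain Q where Q: "Q \<subseteq> A" "finite Q" "\<And>w. \<exists>q\<in>Q. (norm (fst p) + 1) * norm w \<le> w \<bullet> fst q"
    using spread by metis
  define K where "K q = (norm (fst q))\<^sup>2 + snd q - (norm (fst p))\<^sup>2 - snd p" for q :: "'v \<times> real"
  have "norm w \<le> (\<Sum>q\<in>Q. \<bar>K q\<bar>)" if w: "w \<in> laguerre_cell p A" for w
  proof -
    obtain q where q: "q \<in> Q" "(norm (fst p) + 1) * norm w \<le> w \<bullet> fst q" using Q by blast
    have "pow w p \<le> pow w q" using w q Q by (auto simp: laguerre_cell_def)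
    then have "2 * (w \<bullet> fst q - w \<bullet> fst p) \<le> K q"
      using pow_diff[of w p q] by (simp add: K_def inner_diff inner_commute)
    moreover have "w \<bullet> fst p \<le> norm (fst p) * norm w"
      using norm_cauchy_schwarz[of w "fst p"] by (simp add: mult.commute)
    ultimately have "2 * norm w \<le> K q" using q(2) by (simp add: algebra_simps)
    moreover have "\<bar>K q\<bar> \<le> (\<Sum>q\<in>Q. \<bar>K q\<bar>)" using q Q by (intro member_le_sum) auto
    ultimately show ?thesis using norm_ge_zero[of w] by linarith
  qed
  then show ?thesis unfolding bounded_iff by blast
qed

text \<open>Inside a box around the bounded cell only the finitely many sites that reach power
  \<open>t\<close> impose constraints, so the cell is the box cut by finitely many
  half-spaces.\<close>

lemma polytope_laguerre_cell:
  assumes p: "p \<in> A"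
  shows "polytope (laguerre_cell p A)"
proof -
  obtain a where a: "laguerre_cell p A \<subseteq> cbox (-a) a"
    using bounded_laguerre_cell[OF p] bounded_subset_cbox_symmetric by blast
  obtain R where R: "cbox (-a) a \<subseteq> cball 0 R"
    using bounded_cbox[of "-a" a] unfolding bounded_iff mem_cball_0[symmetric] by blast
  obtain t where fin: "finite {p \<in> A. \<exists>w\<in>cball 0 R. pow w p \<le> t}" (is "finite ?F")
    and ex: "\<forall>w\<in>cball 0 R. \<exists>p\<in>A. pow w p \<le> t"
    using locally_determined by blast
  have "laguerre_cell p A = cbox (-a) a \<inter> (\<Inter>q\<in>?F. {w. pow w p \<le> pow w q})" (is "_ = ?D")
  proof
    show "laguerre_cell p A \<subseteq> ?D" using a by (auto simp: laguerre_cell_def)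
    show "?D \<subseteq> laguerre_cell p A"
    proof
      fix w assume w: "w \<in> ?D"
      then have wR: "w \<in> cball 0 R" using R by auto
      then obtain q0 where q0: "q0 \<in> A" "pow w q0 \<le> t" using ex by blast
      then have "pow w p \<le> pow w q0" using w wR by blast
      \<comment> \<open>A site with power above \<open>t\<close> imposes nothing new: the comparison
        with \<open>q0\<close> already bounds the power of \<open>p\<close> by
        \<open>t\<close>.\<close>
      then have "pow w p \<le> pow w q" if "q \<in> A" for q
      proof (cases "pow w q \<le> t")
        case True
        then show ?thesis using w wR that by blast
      qed (use q0 in linarith)
      then show "w \<in> laguerre_cell p A" by (auto simp: laguerre_cell_def)
    qed
  qed
  moreover have "polytope ?D"
    by (intro polytope_Int_polyhedron polytope_interval polyhedron_Inter)
       (use fin in \<open>auto intro: polyhedron_pow_le\<close>)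
  ultimately show ?thesis by simp
qed

lemma tessellation_laguerre_diagram: "tessellation (laguerre_diagram A)"
  unfolding tessellation_def
proof (intro conjI ballI impI allI)
  fix C assume "C \<in> laguerre_diagram A"
  then show "polytope C" "interior C \<noteq> {}"
    using polytope_laguerre_cell by (auto simp: mem_laguerre_diagram_iff)
next
  have "w \<in> \<Union> (laguerre_diagram A)" for w
  proof -
    obtain p where "p \<in> minimizers w" using minimizers_nonempty by blast
    then have "w \<in> laguerre_cell p A" "laguerre_cell p A \<in> laguerre_diagram A"
      using interior_cell_nonempty[of p w] unfolding mem_laguerre_diagram_iff
      by (auto simp: minimizers_def)
    then show ?thesis by (rule UnionI[rotated])
  qed
  then show "\<Union> (laguerre_diagram A) = UNIV" by auto
next
  fix C C' assume "C \<in> laguerre_diagram A" "C' \<in> laguerre_diagram A" "C \<noteq> C'"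
  then show "interior C \<inter> interior C' = {}"
    using interior_cells_disjoint by (metis mem_laguerre_diagram_iff)
next
  fix K :: "'v set" assume "bounded K"
  then obtain R where R: "K \<subseteq> cball 0 R" unfolding bounded_iff mem_cball_0[symmetric] by blast
  obtain t where fin: "finite {p \<in> A. \<exists>w\<in>cball 0 R. pow w p \<le> t}" (is "finite ?F")
    and ex: "\<forall>w\<in>cball 0 R. \<exists>p\<in>A. pow w p \<le> t"
    using locally_determined by blast
  \<comment> \<open>A cell that meets \<open>K\<close> at \<open>w\<close> belongs to a site minimal
    at \<open>w\<close>, whose power there is at most \<open>t\<close>.\<close>
  have "{C \<in> laguerre_diagram A. C \<inter> K \<noteq> {}} \<subseteq> (\<lambda>p. laguerre_cell p A) ` ?F"
  proof
    fix C assume "C \<in> {C \<in> laguerre_diagram A. C \<inter> K \<noteq> {}}"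
    then obtain p w where p: "p \<in> A" "C = laguerre_cell p A" and w: "w \<in> C" "w \<in> cball 0 R"
      using R unfolding mem_laguerre_diagram_iff by blast
    then obtain q where "q \<in> A" "pow w q \<le> t" using ex by blast
    then have "pow w p \<le> t" using p w by (auto simp: laguerre_cell_def intro: order_trans)
    then show "C \<in> (\<lambda>p. laguerre_cell p A) ` ?F" using p w by blast
  qed
  then show "finite {C \<in> laguerre_diagram A. C \<inter> K \<noteq> {}}"
    using fin finite_surj by blast
qed

lemma face_to_face_laguerre_diagram: "face_to_face (laguerre_diagram A)"
  unfolding face_to_face_def
proof (intro conjI ballI tessellation_laguerre_diagram disjI2)
  fix C C' assume "C \<in> laguerre_diagram A" "C' \<in> laguerre_diagram A"
  then show "C \<inter> C' face_of C" "C \<inter> C' face_of C'"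
    using laguerre_cell_Int_face_of by (metis mem_laguerre_diagram_iff Int_commute)+
qed

section \<open>Dimension of faces and normality\<close>

lemma dim_equidistant:
  assumes p0: "p0 \<in> minimizers w"
  shows "dim {z. \<forall>q\<in>minimizers w. (fst q - fst p0) \<bullet> z = 0} + card (minimizers w) = DIM('v) + 1"
proof -
  let ?S = "minimizers w - {p0}"
  let ?g = "\<lambda>q. fst q - fst p0"
  \<comment> \<open>Such a dual vector for each \<open>q\<close> yields both injectivity of
    \<open>?g\<close> on \<open>?S\<close> and independence of its image. The solution space is then
    an orthogonal complement.\<close>
  have sep: "\<exists>u. ?g q \<bullet> u = 1 \<and> (\<forall>r\<in>?S - {q}. ?g r \<bullet> u = 0)" if q: "q \<in> ?S" for q
  proof -
    obtain u where u: "\<And>r s. r \<in> minimizers w \<Longrightarrow> s \<in> minimizers w \<Longrightarrow>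
      (fst r - fst s) \<bullet> u = (if r = q then 1 else 0) - (if s = q then 1 else 0)"
      by (rule separating_direction[of w "\<lambda>r. if r = q then 1 else 0"]) blast
    then show ?thesis using q p0 by (intro exI[of _ u]) auto
  qed
  have inj: "inj_on ?g ?S"
  proof (rule inj_onI)
    fix q r assume qr: "q \<in> ?S" "r \<in> ?S" "?g q = ?g r"
    obtain u where "?g q \<bullet> u = 1" "\<forall>r\<in>?S - {q}. ?g r \<bullet> u = 0" using sep qr by blast
    then show "q = r" using qr by (metis Diff_iff singletonD zero_neq_one)
  qed
  have indep: "independent (?g ` ?S)"
  proof
    assume "dependent (?g ` ?S)"
    then obtain q where q: "q \<in> ?S" "?g q \<in> span (?g ` ?S - {?g q})"
      by (auto simp: dependent_def)
    obtain u where u: "?g q \<bullet> u = 1" "\<forall>r\<in>?S - {q}. ?g r \<bullet> u = 0" using sep q by blast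
    \<comment> \<open>The dual vector kills all the other differences, hence their span, but not
      \<open>?g q\<close> itself.\<close>
    have "orthogonal u (?g q)"
      by (rule orthogonal_to_span[OF q(2)])
         (use u in \<open>unfold orthogonal_def, subst inner_commute, blast\<close>)
    then show False using u by (simp add: orthogonal_def inner_commute)
  qed
  have dim: "dim (span (?g ` ?S)) = card (minimizers w) - 1"
    using dim_span_eq_card_independent[OF indep] card_image[OF inj] p0 minimizers_finite[of w]
    by simp
  have "{z. \<forall>q\<in>minimizers w. ?g q \<bullet> z = 0} = {y \<in> UNIV. \<forall>x\<in>span (?g ` ?S). orthogonal x y}"
  proof (intro equalityI subsetI CollectI conjI UNIV_I ballI)
    fix z x assume z: "z \<in> {z. \<forall>q\<in>minimizers w. ?g q \<bullet> z = 0}" and x: "x \<in> span (?g ` ?S)"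
    have "orthogonal z x"
      by (rule orthogonal_to_span[OF x]) (use z in \<open>auto simp: orthogonal_def inner_commute\<close>)
    then show "orthogonal x z" by (simp add: orthogonal_commute)
  next
    fix z q assume z: "z \<in> {y \<in> UNIV. \<forall>x\<in>span (?g ` ?S). orthogonal x y}" and q: "q \<in> minimizers w"
    show "?g q \<bullet> z = 0"
      using z q span_base[of "?g q" "?g ` ?S"] by (cases "q = p0") (auto simp: orthogonal_def)
  qed
  then have "dim {z. \<forall>q\<in>minimizers w. ?g q \<bullet> z = 0} + dim (span (?g ` ?S)) = DIM('v)"
    using dim_subspace_orthogonal_to_vectors[of "span (?g ` ?S)" UNIV] by simp
  moreover have "card (minimizers w) > 0" using p0 minimizers_finite card_gt_0_iff by blast
  ultimately show ?thesis using dim by simp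
qed

text \<open>Near \<open>w\<close> the set \<open>G\<close> agrees with the flat \<open>L\<close> of
  points at which all minimizers of \<open>w\<close> have equal power. Hence \<open>L\<close> is the
  affine hull of \<open>G\<close>, which yields both claims.\<close>

lemma common_face:
  fixes w
  defines "G \<equiv> \<Inter>p\<in>minimizers w. laguerre_cell p A"
  shows "w \<in> rel_interior G" and "aff_dim G + int (card (minimizers w)) = int DIM('v) + 1"
proof -
  obtain e where e: "e > 0" and near: "\<And>w' p. w' \<in> ball w e \<Longrightarrow> p \<in> A - minimizers w \<Longrightarrow>
           \<exists>q\<in>minimizers w. pow w' q < pow w' p"
    by (rule minimizers_determine_nearby[of w]) blast
  obtain p0 where p0: "p0 \<in> minimizers w" using minimizers_nonempty by blast
  define Z where "Z = {z. \<forall>q\<in>minimizers w. (fst q - fst p0) \<bullet> z = 0}"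
  define L where "L = (+) w ` Z"
  have Z: "subspace Z" unfolding Z_def by (auto simp: subspace_def inner_right_distrib)
  have L_iff: "w' \<in> L \<longleftrightarrow> (\<forall>q\<in>minimizers w. pow w' p0 = pow w' q)" for w'
  proof -
    have "w' \<in> L \<longleftrightarrow> w' - w \<in> Z" unfolding L_def by (auto simp: image_iff algebra_simps) (metis add.commute diff_add_cancel)
    also have "\<dots> \<longleftrightarrow> (\<forall>q\<in>minimizers w. pow w' p0 = pow w' q)"
      unfolding Z_def mem_Collect_eq
    proof (intro ball_cong refl)
      fix q assume "q \<in> minimizers w"
      then show "(fst q - fst p0) \<bullet> (w' - w) = 0 \<longleftrightarrow> pow w' p0 = pow w' q"
        using pow_add_diff[of w "w' - w" p0 q] pow_minimizers_eq[OF p0, of q] by auto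
    qed
    finally show ?thesis .
  qed
  have GL: "G \<inter> ball w e = L \<inter> ball w e"
  proof -
    have "w' \<in> G \<longleftrightarrow> w' \<in> L" if "w' \<in> ball w e" for w'
    proof -
      have "w' \<in> G \<longleftrightarrow> (\<forall>p\<in>minimizers w. \<forall>q\<in>minimizers w. pow w' p \<le> pow w' q)"
        using mem_cell_near[OF near[OF that]] by (simp add: G_def)
      also have "\<dots> \<longleftrightarrow> w' \<in> L" unfolding L_iff using p0 by (metis order_antisym order_refl)
      finally show ?thesis .
    qed
    then show ?thesis by blast
  qed
  have convG: "convex G" unfolding G_def by (intro convex_INT convex_laguerre_cell)
  have affL: "affine L" unfolding L_def using Z affine_translation subspace_imp_affine by blast
  have wL: "w \<in> L" unfolding L_iff using pow_minimizers_eq[OF p0] by blast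
  have we: "w \<in> ball w e" using e by simp
  have wG: "w \<in> G" using wL we GL by blast
  have ne: "G \<inter> ball w e \<noteq> {}" "L \<inter> ball w e \<noteq> {}" using wL wG we by blast+
  \<comment> \<open>Cutting a convex set with an open set that meets it does not change the affine
    hull.\<close>
  have hull: "affine hull G = L"
    using affine_hull_convex_Int_open[OF convG open_ball ne(1)]
      affine_hull_convex_Int_open[OF affine_imp_convex[OF affL] open_ball ne(2)] GL
    by (simp add: affine_hull_eq affL hull_same)
  show "w \<in> rel_interior G"
    unfolding mem_rel_interior_ball hull using wG GL e by blast
  have "aff_dim G = aff_dim L" using hull by (metis aff_dim_affine_hull)
  also have "\<dots> = int (dim Z)" by (simp add: L_def aff_dim_translation_eq aff_dim_subspace Z)
  finally show "aff_dim G + int (card (minimizers w)) = int DIM('v) + 1"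
    using dim_equidistant[OF p0] by (simp add: Z_def)
qed

text \<open>For \<open>w\<close> in the relative interior of a face \<open>F\<close>, the cells that
  contain \<open>F\<close> are exactly those of the minimizers at \<open>w\<close>, and
  \<open>F\<close> is their intersection. The dimension formula of \<open>common_face\<close> then
  counts them.\<close>

theorem normal_tessellation_laguerre_diagram: "normal_tessellation (laguerre_diagram A)"
  unfolding normal_tessellation_def
proof (intro conjI face_to_face_laguerre_diagram ballI allI impI)
  fix C F assume C: "C \<in> laguerre_diagram A"
    and F: "F face_of C \<and> 0 \<le> aff_dim F \<and> aff_dim F < int DIM('v)"
  then obtain p where p: "p \<in> A" "C = laguerre_cell p A" by (auto simp: mem_laguerre_diagram_iff)
  have "F \<noteq> {}" "convex F" using F face_of_imp_convex by auto
  then obtain w where w: "w \<in> rel_interior F" using rel_interior_eq_empty by blast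
  then have wF: "w \<in> F" using rel_interior_subset by blast
  have FC: "F \<subseteq> C" using F face_of_imp_subset by blast
  have pw: "p \<in> minimizers w" using p wF FC by (auto simp: minimizers_def)
  have sub: "F \<subseteq> laguerre_cell q A \<longleftrightarrow> q \<in> minimizers w" if q: "q \<in> A" for q
  proof
    assume "q \<in> minimizers w"
    then have "w \<in> laguerre_cell q A" by (auto simp: minimizers_def)
    \<comment> \<open>A face that contains a relative interior point of a convex subset of the cell
      contains the whole subset.\<close>
    then have "F \<subseteq> laguerre_cell p A \<inter> laguerre_cell q A"
      using subset_of_face_of[OF laguerre_cell_Int_face_of[OF p(1) q], of F] FC p w wF by blast
    then show "F \<subseteq> laguerre_cell q A" by blast
  qed (use wF q in \<open>auto simp: minimizers_def\<close>)
  let ?G = "\<Inter>p\<in>minimizers w. laguerre_cell p A"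
  have "F = ?G"
  proof
    show "F \<subseteq> ?G" using sub by (auto simp: minimizers_def)
    \<comment> \<open>The same principle with the roles exchanged: \<open>w\<close> is a relative
      interior point of \<open>?G\<close> and lies in the face \<open>F\<close>.\<close>
    show "?G \<subseteq> F"
      using subset_of_face_of[of F C ?G] F common_face(1)[of w] wF pw p by blast
  qed
  moreover have "{C' \<in> laguerre_diagram A. F \<subseteq> C'} = (\<lambda>q. laguerre_cell q A) ` minimizers w"
    using sub interior_cell_nonempty by (auto simp: mem_laguerre_diagram_iff minimizers_def)
  \<comment> \<open>The diagram is a set of cells, so counting needs distinct cells for distinct
    minimizers; their interiors are nonempty and disjoint.\<close>
  moreover have "inj_on (\<lambda>q. laguerre_cell q A) (minimizers w)"
    by (rule inj_onI)
       (metis (no_types, lifting) interior_cells_disjoint interior_cell_nonempty Int_absorb minimizers_def mem_Collect_eq)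
  ultimately show "int (card {C' \<in> laguerre_diagram A. F \<subseteq> C'}) = int DIM('v) + 1 - aff_dim F"
    using common_face(2)[of w] by (simp add: card_image)
qed

end

section \<open>Poisson processes\<close>

lemma pcount_eq_0_iff: "pcount A B = enat 0 \<longleftrightarrow> A \<inter> B = {}"
  by (auto simp: pcount_def)

lemma pcount_eq_1_iff: "pcount A B = enat (Suc 0) \<longleftrightarrow> (\<exists>x. A \<inter> B = {x})"
  by (auto simp: pcount_def card_1_singleton_iff)

text \<open>Expresses the location of the only point in \<open>U\<close> through the counts of two
  disjoint sets, to which independence of counts applies.\<close>

lemma singleton_Int_split:
  "(\<exists>x\<in>B. A \<inter> U = {x}) \<longleftrightarrow> (\<exists>x. A \<inter> (U \<inter> B) = {x}) \<and> A \<inter> (U - B) = {}"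
proof (intro iffI conjI)
  assume "\<exists>x\<in>B. A \<inter> U = {x}"
  then obtain x where x: "x \<in> B" "A \<inter> U = {x}" by blast
  then have "A \<inter> (U \<inter> B) = {x}" by blast
  then show "\<exists>x. A \<inter> (U \<inter> B) = {x}" by blast
  show "A \<inter> (U - B) = {}" using x by (auto simp: set_eq_iff)
next
  assume *: "(\<exists>x. A \<inter> (U \<inter> B) = {x}) \<and> A \<inter> (U - B) = {}"
  then obtain x where x: "A \<inter> (U \<inter> B) = {x}" by blast
  have "A \<inter> U = A \<inter> (U \<inter> B)" using * by blast
  then show "\<exists>x\<in>B. A \<inter> U = {x}" using x by (intro bexI[of _ x]) auto
qed

locale poisson =
  fixes M :: "'a measure" and eta :: "'a \<Rightarrow> 'b set" and Lam :: "'b measure"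
  assumes PPP: "poisson_process M eta Lam"
begin

sublocale prob_space M
  using PPP by (simp add: poisson_process_def)

lemma measurable_pcount:
  "B \<in> sets Lam \<Longrightarrow> (\<lambda>\<omega>. pcount (eta \<omega>) B) \<in> measurable M (count_space UNIV)"
  using PPP by (simp add: poisson_process_def)

lemma sets_pcount_eq: "B \<in> sets Lam \<Longrightarrow> {\<omega> \<in> space M. pcount (eta \<omega>) B = c} \<in> sets M"
  using measurable_sets[OF measurable_pcount, of B "{c}"]
  by (simp add: vimage_def Int_def conj_commute)

lemma prob_pcount_eq:
  assumes "B \<in> sets Lam" "emeasure Lam B < \<infinity>"
  shows "prob {\<omega> \<in> space M. pcount (eta \<omega>) B = enat k} =
    exp (- measure Lam B) * measure Lam B ^ k / fact k"
  using PPP assms by (simp add: poisson_process_def measure_def)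

lemma indep_pcount:
  fixes I :: "nat set"
  assumes "finite I" "\<And>i. i \<in> I \<Longrightarrow> B i \<in> sets Lam" "disjoint_family_on B I"
  shows "indep_vars (\<lambda>_. count_space UNIV) (\<lambda>i \<omega>. pcount (eta \<omega>) (B i)) I"
  using PPP assms by (simp add: poisson_process_def)

text \<open>The Poisson probabilities of the finite counts already sum to 1, by the exponential
  series.\<close>

lemma AE_finite:
  assumes B: "B \<in> sets Lam" "emeasure Lam B < \<infinity>"
  shows "AE \<omega> in M. finite (eta \<omega> \<inter> B)"
proof -
  let ?A = "\<lambda>k. {\<omega> \<in> space M. pcount (eta \<omega>) B = enat k}"
  have "(\<lambda>k. prob (?A k)) sums prob (\<Union>k. ?A k)"
    by (rule finite_measure_UNION) (auto simp: disjoint_family_on_def intro: sets_pcount_eq[OF B(1)])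
  moreover have "(\<lambda>k. prob (?A k)) sums (exp (- measure Lam B) * exp (measure Lam B))"
  proof -
    have "(\<lambda>k. exp (- measure Lam B) * (measure Lam B ^ k / fact k)) sums
        (exp (- measure Lam B) * exp (measure Lam B))"
      using exp_converges[of "measure Lam B"] by (intro sums_mult) (simp add: field_simps)
    then show ?thesis by (simp add: prob_pcount_eq[OF B])
  qed
  ultimately have "prob (\<Union>k. ?A k) = 1"
    using sums_unique2 by (fastforce simp: exp_minus)
  moreover have "(\<Union>k. ?A k) \<in> events" using sets_pcount_eq[OF B(1)] by auto
  ultimately have "AE \<omega> in M. \<omega> \<in> (\<Union>k. ?A k)" using prob_eq_1 by blast
  then show ?thesis by (rule AE_mp) (auto simp: pcount_def split: if_splits)
qed

lemma AE_nonempty: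
  assumes "B \<in> sets Lam" "emeasure Lam B = \<infinity>"
  shows "AE \<omega> in M. eta \<omega> \<inter> B \<noteq> {}"
proof -
  have "AE \<omega> in M. pcount (eta \<omega>) B = \<infinity>"
    using PPP assms by (simp add: poisson_process_def)
  then show ?thesis by (rule AE_mp) (auto simp: pcount_def)
qed

lemma sets_void: "B \<in> sets Lam \<Longrightarrow> {\<omega> \<in> space M. eta \<omega> \<inter> B = {}} \<in> sets M"
  using sets_pcount_eq[of B "enat 0"] by (simp add: pcount_eq_0_iff)

lemma prob_void_le:
  assumes B: "B \<in> sets Lam" and L: "ennreal L \<le> emeasure Lam B"
  shows "prob {\<omega> \<in> space M. eta \<omega> \<inter> B = {}} \<le> exp (- L)"
proof (cases "emeasure Lam B < \<infinity>")
  case True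
  then have "L \<le> measure Lam B"
    using L by (metis emeasure_eq_ennreal_measure ennreal_le_iff less_irrefl measure_nonneg
        infinity_ennreal_def)
  then show ?thesis using prob_pcount_eq[OF B True, of 0] by (simp add: pcount_eq_0_iff)
next
  case False
  then have "emeasure Lam B = \<infinity>" by (simp add: less_top[symmetric])
  from AE_nonempty[OF B this] have "prob {\<omega> \<in> space M. eta \<omega> \<inter> B = {}} = 0"
    by (subst prob_eq_0[OF sets_void[OF B]]) auto
  then show ?thesis by simp
qed

text \<open>Each \<open>U i\<close> is split into the part inside \<open>B i\<close>, with one
  point, and the part outside, with none. All these counts are independent, and the two exponential
  factors recombine into one.\<close>

lemma prob_isolated_in:
  fixes I :: "nat set"
  assumes I: "finite I" "I \<noteq> {}"
    and U: "\<And>i. i \<in> I \<Longrightarrow> U i \<in> sets Lam" "\<And>i. i \<in> I \<Longrightarrow> emeasure Lam (U i) < \<infinity>"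
    and disj: "disjoint_family_on U I"
    and B: "\<And>i. i \<in> I \<Longrightarrow> B i \<in> sets Lam"
  shows "prob {\<omega> \<in> space M. \<forall>i\<in>I. \<exists>x\<in>B i. eta \<omega> \<inter> U i = {x}} =
    (\<Prod>i\<in>I. exp (- measure Lam (U i)) * measure Lam (U i \<inter> B i))"
proof -
  \<comment> \<open>Even indices carry the parts inside \<open>B i\<close> and odd indices the parts
    outside, because independence of counts is available for families indexed by naturals.\<close>
  define C where "C j = (if even j then U (j div 2) \<inter> B (j div 2) else U (j div 2) - B (j div 2))"
    for j :: nat
  define c where "c j = (if even j then enat (Suc 0) else enat 0)" for j :: nat
  define J where "J = (\<lambda>i. 2 * i) ` I \<union> (\<lambda>i. Suc (2 * i)) ` I"
  let ?E = "\<lambda>j. {\<omega> \<in> space M. pcount (eta \<omega>) (C j) = c j}"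
  have J: "finite J" "J \<noteq> {}" using I by (auto simp: J_def)
  have C: "C j \<in> sets Lam" if "j \<in> J" for j using that U B by (auto simp: C_def J_def)
  have Cfin: "emeasure Lam (U i \<inter> B i) < \<infinity>" "emeasure Lam (U i - B i) < \<infinity>" if "i \<in> I" for i
    using U(2)[OF that] U(1)[OF that] B[OF that]
    by (auto intro: le_less_trans[OF emeasure_mono])
  have "disjoint_family_on C J"
  proof (unfold disjoint_family_on_def, intro ballI impI)
    fix j k assume jk: "j \<in> J" "k \<in> J" "j \<noteq> k"
    show "C j \<inter> C k = {}"
    proof (cases "j div 2 = k div 2")
      case True
      then have "even j \<noteq> even k" using jk(3) by (metis even_two_times_div_two odd_two_times_div_two_succ)
      then show ?thesis using True by (auto simp: C_def)
    next
      case False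
      then have "U (j div 2) \<inter> U (k div 2) = {}"
        using disj jk by (intro disjoint_family_onD[OF disj]) (auto simp: J_def)
      then show ?thesis by (auto simp: C_def)
    qed
  qed
  then have ind: "indep_vars (\<lambda>_. count_space UNIV) (\<lambda>i \<omega>. pcount (eta \<omega>) (C i)) J"
    using J C by (intro indep_pcount) auto
  have "{\<omega> \<in> space M. \<forall>i\<in>I. \<exists>x\<in>B i. eta \<omega> \<inter> U i = {x}} = (\<Inter>j\<in>J. ?E j)"
  proof -
    have "(\<exists>x\<in>B i. A \<inter> U i = {x}) \<longleftrightarrow>
        pcount A (C (2 * i)) = c (2 * i) \<and> pcount A (C (Suc (2 * i))) = c (Suc (2 * i))" for A i
      unfolding C_def c_def by (simp add: pcount_eq_1_iff pcount_eq_0_iff singleton_Int_split)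
    then show ?thesis using I unfolding J_def by auto
  qed
  then have "prob {\<omega> \<in> space M. \<forall>i\<in>I. \<exists>x\<in>B i. eta \<omega> \<inter> U i = {x}} = prob (\<Inter>j\<in>J. ?E j)" by simp
  also have "\<dots> = (\<Prod>j\<in>J. prob (?E j))"
    using indep_varsD[OF ind J(2,1) order_refl, of "\<lambda>j. {c j}"]
    by (simp add: vimage_def Int_def conj_commute)
  also have "\<dots> = (\<Prod>i\<in>I. prob (?E (2 * i))) * (\<Prod>i\<in>I. prob (?E (Suc (2 * i))))"
    unfolding J_def
    by (subst prod.union_disjoint)
       (use I in \<open>auto simp: prod.reindex inj_on_def, presburger\<close>)
  also have "\<dots> = (\<Prod>i\<in>I. prob (?E (2 * i)) * prob (?E (Suc (2 * i))))"
    by (simp add: prod.distrib)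
  also have "\<dots> = (\<Prod>i\<in>I. exp (- measure Lam (U i)) * measure Lam (U i \<inter> B i))"
  proof (rule prod.cong[OF refl])
    fix i assume i: "i \<in> I"
    have "prob (?E (2 * i)) = exp (- measure Lam (U i \<inter> B i)) * measure Lam (U i \<inter> B i)"
      using prob_pcount_eq[of "U i \<inter> B i" 1] Cfin[OF i] U B i by (simp add: C_def c_def)
    moreover have "prob (?E (Suc (2 * i))) = exp (- measure Lam (U i - B i))"
      using prob_pcount_eq[of "U i - B i" 0] Cfin[OF i] U B i by (simp add: C_def c_def)
    moreover have "measure Lam (U i) = measure Lam (U i \<inter> B i) + measure Lam (U i - B i)"
      using measure_Union[of Lam "U i \<inter> B i" "U i - B i"] Cfin[OF i] U B i
      by (simp add: Int_Diff_Un Int_Diff_disjoint less_top)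
    ultimately show "prob (?E (2 * i)) * prob (?E (Suc (2 * i))) =
        exp (- measure Lam (U i)) * measure Lam (U i \<inter> B i)"
      by (simp add: exp_add[symmetric] algebra_simps)
  qed
  finally show ?thesis .
qed

text \<open>On the event that each \<open>U i\<close> contains exactly one point, the joint law of these points is a
  product measure with marginals proportional to the restrictions of \<open>Lam\<close>.\<close>

lemma AE_no_isolated_tuple:
  fixes I :: "nat set"
  defines "N \<equiv> \<lambda>U i. density Lam (\<lambda>x. ennreal (exp (- measure Lam (U i))) * indicator (U i) x)"
  assumes I: "finite I" "I \<noteq> {}"
    and U: "\<And>i. U i \<in> sets Lam" "\<And>i. emeasure Lam (U i) < \<infinity>"
    and disj: "disjoint_family_on U I"
    and D: "D \<in> sets (PiM I (N U))" "emeasure (PiM I (N U)) D = 0"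
  shows "AE \<omega> in M. \<forall>x\<in>D. \<exists>i\<in>I. eta \<omega> \<inter> U i \<noteq> {x i}"
proof -
  define O1 where "O1 = {\<omega> \<in> space M. \<forall>i\<in>I. pcount (eta \<omega>) (U i) = enat (Suc 0)}"
  define X where "X \<omega> = (\<lambda>i\<in>I. the_elem (eta \<omega> \<inter> U i))" for \<omega>
  have [measurable]: "O1 \<in> sets M"
  proof -
    have "O1 = (\<Inter>i\<in>I. {\<omega> \<in> space M. pcount (eta \<omega>) (U i) = enat (Suc 0)})" using I by (auto simp: O1_def)
    then show ?thesis using I U sets_pcount_eq by auto
  qed
  have sN[simp]: "sets (N U i) = sets Lam" "space (N U i) = space Lam" for i by (simp_all add: N_def)
  have eN: "emeasure (N U i) B = ennreal (exp (- measure Lam (U i)) * measure Lam (U i \<inter> B))"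
    if "B \<in> sets Lam" for B i
  proof -
    have "emeasure (N U i) B =
        (\<integral>\<^sup>+x. ennreal (exp (- measure Lam (U i))) * indicator (U i \<inter> B) x \<partial>Lam)"
      unfolding N_def using that U
      by (subst emeasure_density) (auto intro!: nn_integral_cong split: split_indicator)
    also have "\<dots> = ennreal (exp (- measure Lam (U i))) * emeasure Lam (U i \<inter> B)"
      using that U by (simp add: nn_integral_cmult)
    also have "emeasure Lam (U i \<inter> B) = ennreal (measure Lam (U i \<inter> B))"
      using U(2)[of i] U(1)[of i] that
      by (intro emeasure_eq_ennreal_measure)
         (metis emeasure_mono inf_le1 infinity_ennreal_def leD top.not_eq_extremum)
    finally show ?thesis by (simp add: ennreal_mult)
  qed
  have fN: "finite_measure (N U i)" for i
    using eN[of "space Lam" i] by (intro finite_measureI) simp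
  interpret product_sigma_finite "N U"
    by (intro product_sigma_finite.intro finite_measure.axioms(1)[OF fN])
  have the: "the_elem (eta \<omega> \<inter> U i) = x \<longleftrightarrow> eta \<omega> \<inter> U i = {x}" if wi: "\<omega> \<in> O1" "i \<in> I" for \<omega> i x
  proof -
    obtain y where "eta \<omega> \<inter> U i = {y}" using wi by (auto simp: O1_def pcount_eq_1_iff)
    then show ?thesis by simp
  qed
  \<comment> \<open>Off \<open>O1\<close> some \<open>U i\<close> does not contain exactly one point
    and \<open>the_elem\<close> is unspecified, so \<open>X\<close> is treated on the restricted
    space only.\<close>
  have Xmeas: "X \<in> measurable (restrict_space M O1) (PiM I (N U))"
    unfolding X_def
  proof (rule measurable_restrict, rule measurableI)
    fix i \<omega> assume i: "i \<in> I" and w: "\<omega> \<in> space (restrict_space M O1)"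
    then have "\<omega> \<in> O1" by (simp add: space_restrict_space)
    then have "the_elem (eta \<omega> \<inter> U i) \<in> U i" using the[OF _ i] by blast
    then show "the_elem (eta \<omega> \<inter> U i) \<in> space (N U i)"
      using sets.sets_into_space[OF U(1)] by auto
  next
    fix i B assume i: "i \<in> I" and "B \<in> sets (N U i)"
    then have B: "B \<in> sets Lam" by simp
    have "(\<lambda>\<omega>. the_elem (eta \<omega> \<inter> U i)) -` B \<inter> space (restrict_space M O1) =
        O1 \<inter> {\<omega> \<in> space M. pcount (eta \<omega>) (U i \<inter> B) = enat (Suc 0)}"
    proof (intro equalityI subsetI)
      fix \<omega> assume w: "\<omega> \<in> (\<lambda>\<omega>. the_elem (eta \<omega> \<inter> U i)) -` B \<inter> space (restrict_space M O1)"
      then have wO: "\<omega> \<in> O1" by (simp add: space_restrict_space)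
      then obtain x where x: "eta \<omega> \<inter> U i = {x}" using i by (auto simp: O1_def pcount_eq_1_iff)
      then have "x \<in> B" using w the[OF wO i] by auto
      then have "eta \<omega> \<inter> (U i \<inter> B) = {x}" using x by blast
      then show "\<omega> \<in> O1 \<inter> {\<omega> \<in> space M. pcount (eta \<omega>) (U i \<inter> B) = enat (Suc 0)}"
        using wO unfolding pcount_eq_1_iff by (auto simp: O1_def)
    next
      fix \<omega> assume w: "\<omega> \<in> O1 \<inter> {\<omega> \<in> space M. pcount (eta \<omega>) (U i \<inter> B) = enat (Suc 0)}"
      then have wO: "\<omega> \<in> O1" by auto
      then obtain x where x: "eta \<omega> \<inter> U i = {x}" using i by (auto simp: O1_def pcount_eq_1_iff)
      obtain y where "eta \<omega> \<inter> (U i \<inter> B) = {y}" using w unfolding pcount_eq_1_iff by auto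
      then have "y \<in> eta \<omega> \<inter> U i" "y \<in> B" by auto
      then have "x \<in> B" unfolding x by simp
      then show "\<omega> \<in> (\<lambda>\<omega>. the_elem (eta \<omega> \<inter> U i)) -` B \<inter> space (restrict_space M O1)"
        using wO the[OF wO i] x by (auto simp: space_restrict_space)
    qed
    moreover have "O1 \<inter> {\<omega> \<in> space M. pcount (eta \<omega>) (U i \<inter> B) = enat (Suc 0)} \<in> sets M"
      using sets_pcount_eq[of "U i \<inter> B"] B U by auto
    ultimately show "(\<lambda>\<omega>. the_elem (eta \<omega> \<inter> U i)) -` B \<inter> space (restrict_space M O1)
        \<in> sets (restrict_space M O1)"
      by (subst sets_restrict_space_iff) auto
  qed
  \<comment> \<open>The product measure is determined by its values on boxes, and
    \<open>prob_isolated_in\<close> computes these.\<close>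
  have "distr (restrict_space M O1) (PiM I (N U)) X = PiM I (N U)"
  proof (rule PiM_eqI[OF I(1)])
    fix B assume "\<And>i. i \<in> I \<Longrightarrow> B i \<in> sets (N U i)"
    then have B: "\<And>i. i \<in> I \<Longrightarrow> B i \<in> sets Lam" by simp
    have sub: "X -` Pi\<^sub>E I B \<inter> space (restrict_space M O1) =
        {\<omega> \<in> space M. \<forall>i\<in>I. \<exists>x\<in>B i. eta \<omega> \<inter> U i = {x}}" (is "?L = ?R")
    proof (intro equalityI subsetI)
      fix \<omega> assume w: "\<omega> \<in> ?L"
      then have wO: "\<omega> \<in> O1" by (simp add: space_restrict_space)
      have "\<forall>i\<in>I. \<exists>x\<in>B i. eta \<omega> \<inter> U i = {x}"
    proof
        fix i assume i: "i \<in> I"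
        then have "the_elem (eta \<omega> \<inter> U i) \<in> B i" using w by (auto simp: X_def PiE_iff)
        then show "\<exists>x\<in>B i. eta \<omega> \<inter> U i = {x}" using the[OF wO i] by blast
      qed
      then show "\<omega> \<in> ?R" using wO by (auto simp: O1_def)
    next
      fix \<omega> assume w: "\<omega> \<in> ?R"
      then have "\<omega> \<in> O1" unfolding O1_def pcount_eq_1_iff by auto
      then show "\<omega> \<in> ?L" using w by (auto simp: space_restrict_space X_def)
    qed
    have PB: "Pi\<^sub>E I B \<in> sets (PiM I (N U))" using B I by (intro sets_PiM_I_finite) auto
    have "?L \<in> sets (restrict_space M O1)" using Xmeas PB by (rule measurable_sets)
    then have sO: "?R \<subseteq> O1" "?R \<in> sets M"
      using sub by (auto simp: sets_restrict_space_iff)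
    have "emeasure (distr (restrict_space M O1) (PiM I (N U)) X) (Pi\<^sub>E I B) = emeasure M ?R"
      unfolding emeasure_distr[OF Xmeas PB] sub
      by (rule emeasure_restrict_space) (use sO in auto)
    also have "\<dots> = (\<Prod>i\<in>I. ennreal (exp (- measure Lam (U i)) * measure Lam (U i \<inter> B i)))"
      by (simp add: emeasure_eq_measure prob_isolated_in[OF I U disj B] prod_ennreal)
    also have "\<dots> = (\<Prod>i\<in>I. emeasure (N U i) (B i))"
      by (intro prod.cong refl eN[symmetric] B)
    finally show "emeasure (distr (restrict_space M O1) (PiM I (N U)) X) (Pi\<^sub>E I B) =
      (\<Prod>i\<in>I. emeasure (N U i) (B i))" .
  qed simp
  then have null: "emeasure (restrict_space M O1) (X -` D \<inter> space (restrict_space M O1)) = 0"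
    using D emeasure_distr[OF Xmeas D(1)] by simp
  have meas: "X -` D \<inter> O1 \<in> sets M"
    using measurable_sets[OF Xmeas D(1)] by (auto simp: sets_restrict_space_iff space_restrict_space)
  have "X -` D \<inter> O1 \<in> null_sets M"
    using null meas by (intro null_setsI) (auto simp: space_restrict_space emeasure_restrict_space)
  then show ?thesis
  proof (rule AE_I')
    show "{\<omega> \<in> space M. \<not> (\<forall>x\<in>D. \<exists>i\<in>I. eta \<omega> \<inter> U i \<noteq> {x i})} \<subseteq> X -` D \<inter> O1"
    proof
      fix \<omega> assume "\<omega> \<in> {\<omega> \<in> space M. \<not> (\<forall>x\<in>D. \<exists>i\<in>I. eta \<omega> \<inter> U i \<noteq> {x i})}"
      then obtain x where x: "\<omega> \<in> space M" "x \<in> D" "\<And>i. i \<in> I \<Longrightarrow> eta \<omega> \<inter> U i = {x i}" by auto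
      \<comment> \<open>Both \<open>x\<close> and \<open>X \<omega>\<close> take the default value
        outside \<open>I\<close>, so agreement on \<open>I\<close> is equality.\<close>
      have "x \<in> extensional I" using sets.sets_into_space[OF D(1)] x(2) by (auto simp: space_PiM PiE_def)
      then have "X \<omega> = x" using x(3) by (auto simp: X_def fun_eq_iff extensional_def)
      moreover have "\<omega> \<in> O1" using x unfolding O1_def pcount_eq_1_iff by auto
      ultimately show "\<omega> \<in> X -` D \<inter> O1" using x by auto
    qed
  qed
qed

end

text \<open>Distinct points of the process can be isolated from each other and from the remaining
  points of some \<open>K k\<close> by basic open sets. There are countably many choices of these
  sets and of \<open>k\<close>, and for each one Fubini in the last coordinate shows that
  \<open>D\<close> is null for the joint law of the isolated points.\<close>

lemma poisson_AE_no_null_configuration: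
  fixes eta :: "'a \<Rightarrow> 'b::{metric_space, second_countable_topology} set" and D :: "(nat \<Rightarrow> 'b) set"
  assumes P: "poisson_process M eta Lam" and sL: "sets Lam = sets borel"
    and K: "incseq K" "\<And>k. K k \<in> sets Lam" "\<And>k. emeasure Lam (K k) < \<infinity>" "(\<Union>k. K k) = UNIV"
    and D: "D \<in> sets (PiM {..m} (\<lambda>_. borel))"
    and null: "\<And>x. x \<in> {..<m} \<rightarrow>\<^sub>E UNIV \<Longrightarrow> {y. x(m := y) \<in> D} \<in> null_sets Lam"
  shows "AE \<omega> in M. \<forall>x\<in>D. (\<forall>i\<le>m. x i \<in> eta \<omega>) \<longrightarrow> \<not> inj_on x {..m}"
proof -
  interpret poisson M eta Lam using P by unfold_locales
  define N where "N = (\<lambda>U (i::nat). density Lam (\<lambda>x. ennreal (exp (- measure Lam (U i))) * indicator (U i) x))"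
  obtain \<B> :: "'b set set" where \<B>: "countable \<B>" "topological_basis \<B>"
    using ex_countable_basis by blast
  have iso: "AE \<omega> in M. \<forall>x\<in>D. \<exists>i\<in>{..m}. eta \<omega> \<inter> U i \<noteq> {x i}"
    if U: "\<And>i. U i \<in> sets Lam" "\<And>i. emeasure Lam (U i) < \<infinity>" and disj: "disjoint_family_on U {..m}" for U
  proof -
    have sN: "sets (N U i) = sets Lam" "space (N U i) = UNIV" for i
      using sets_eq_imp_space_eq[OF sL] by (simp_all add: N_def)
    have fN: "finite_measure (N U i)" for i
    proof
      have "emeasure (N U i) (space (N U i)) = ennreal (exp (- measure Lam (U i))) * emeasure Lam (U i)"
        unfolding N_def using U(1)[of i]
        by (simp add: emeasure_density nn_integral_cmult cong: nn_integral_cong)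
      then show "emeasure (N U i) (space (N U i)) \<noteq> \<infinity>"
        using U(2)[of i] by (simp add: ennreal_mult_eq_top_iff less_top[symmetric])
    qed
    interpret product_sigma_finite "N U"
      by (intro product_sigma_finite.intro finite_measure.axioms(1)[OF fN])
    have sPi: "sets (PiM {..m} (N U)) = sets (PiM {..m} (\<lambda>_. borel))"
      by (intro sets_PiM_cong refl) (simp add: sN sL)
    have ins: "insert m {..<m} = {..m}" by auto
    have "emeasure (PiM {..m} (N U)) D = (\<integral>\<^sup>+x. indicator D x \<partial>PiM (insert m {..<m}) (N U))"
      using D sPi by (simp add: ins)
    also have "\<dots> = (\<integral>\<^sup>+x. (\<integral>\<^sup>+y. indicator D (x(m := y)) \<partial>N U m) \<partial>PiM {..<m} (N U))"
      using D sPi by (intro product_nn_integral_insert) (auto simp: ins intro!: borel_measurable_indicator)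
    also have "\<dots> = (\<integral>\<^sup>+x. 0 \<partial>PiM {..<m} (N U))"
    proof (rule nn_integral_cong)
      fix x assume "x \<in> space (PiM {..<m} (N U))"
      then have "x \<in> {..<m} \<rightarrow>\<^sub>E UNIV" by (simp add: space_PiM sN)
      then have "AE y in Lam. x(m := y) \<notin> D"
        by (intro AE_I'[OF null]) auto
      then have "AE y in N U m. indicator D (x(m := y)) = (0::ennreal)"
        unfolding N_def using U(1)[of m] by (subst AE_density) (auto simp: indicator_def)
      then show "(\<integral>\<^sup>+y. indicator D (x(m := y)) \<partial>N U m) = 0"
        using nn_integral_cong_AE by fastforce
    qed
    finally have "emeasure (PiM {..m} (N U)) D = 0" by simp
    then show ?thesis
      using AE_no_isolated_tuple[of "{..m}" U D] U disj D sPi by (simp add: N_def)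
  qed
  \<comment> \<open>Intersecting with \<open>K k\<close> gives finite intensity; the empty set
    beyond \<open>m\<close> is there because \<open>iso\<close> asks for admissible sets at every
    index.\<close>
  let ?V = "\<lambda>V k i. if i \<le> m then V i \<inter> K k else {}"
  have "AE \<omega> in M. \<forall>k. finite (eta \<omega> \<inter> K k)"
    using AE_finite K by (simp add: AE_all_countable)
  moreover have "AE \<omega> in M. \<forall>V\<in>{..m} \<rightarrow>\<^sub>E \<B>. \<forall>k. disjoint_family_on (?V V k) {..m} \<longrightarrow>
      (\<forall>x\<in>D. \<exists>i\<in>{..m}. eta \<omega> \<inter> ?V V k i \<noteq> {x i})"
  proof (intro AE_ball_countable' AE_all_countable[THEN iffD2] allI countable_PiE \<B>(1) finite_atMost)
    fix V k assume V: "V \<in> {..m} \<rightarrow>\<^sub>E \<B>"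
    have VS: "?V V k i \<in> sets Lam" for i
    proof (cases "i \<le> m")
      case True
      then have "V i \<in> \<B>" using V by auto
      then have "open (V i)" using \<B>(2) by (simp add: topological_basis_open)
      then show ?thesis using K(2)[of k] sL by auto
    qed auto
    moreover have "emeasure Lam (?V V k i) < \<infinity>" for i
    proof -
      have "emeasure Lam (?V V k i) \<le> emeasure Lam (K k)" by (rule emeasure_mono) (use K in auto)
      then show ?thesis using K(3)[of k] by (rule le_less_trans)
    qed
    ultimately show "AE \<omega> in M. disjoint_family_on (?V V k) {..m} \<longrightarrow>
      (\<forall>x\<in>D. \<exists>i\<in>{..m}. eta \<omega> \<inter> ?V V k i \<noteq> {x i})"
      using iso[of "?V V k"] by (cases "disjoint_family_on (?V V k) {..m}") auto
  qed
  ultimately show ?thesis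
  proof eventually_elim
    case (elim \<omega>)
    show ?case
    proof (intro ballI impI notI)
      fix x assume x: "x \<in> D" "\<forall>i\<le>m. x i \<in> eta \<omega>" and inj: "inj_on x {..m}"
      have "\<exists>k. x ` {..m} \<subseteq> K k"
      proof -
        have "\<forall>i. \<exists>k. x i \<in> K k" using K(4) by blast
        then obtain f where f: "\<And>i. x i \<in> K (f i)" using choice[of "\<lambda>i k. x i \<in> K k"] by blast
        have "x i \<in> K (Max (f ` {..m}))" if "i \<le> m" for i
          using f[of i] monoD[OF K(1), of "f i" "Max (f ` {..m})"] that by auto
        then show ?thesis by blast
      qed
      then obtain k where k: "\<And>i. i \<le> m \<Longrightarrow> x i \<in> K k" by blast
      have fin: "finite (eta \<omega> \<inter> K k)" using elim by blast
      have "\<forall>i. \<exists>d>0. \<forall>y\<in>eta \<omega> \<inter> K k. y \<noteq> x i \<longrightarrow> d \<le> dist (x i) y"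
        using finite_set_avoid[OF fin] by blast
      then obtain d where d: "\<And>i. d i > 0" "\<And>i y. y \<in> eta \<omega> \<inter> K k \<Longrightarrow> y \<noteq> x i \<Longrightarrow> d i \<le> dist (x i) y"
        by metis
      \<comment> \<open>All points of the process in \<open>K k\<close> other than
        \<open>x i\<close> are at distance at least \<open>e\<close> from \<open>x i\<close>. Balls
        of radius \<open>e / 2\<close> are therefore disjoint and isolate the points.\<close>
      define e where "e = Min (d ` {..m})"
      have e0: "e > 0" using d(1) by (auto simp: e_def)
      have e: "e \<le> dist (x i) y" if "i \<le> m" "y \<in> eta \<omega> \<inter> K k" "y \<noteq> x i" for i y
      proof -
        have "e \<le> d i" using that by (auto simp: e_def)
        then show ?thesis using d(2)[OF that(2,3)] by simp
      qed
      have "\<forall>i. \<exists>V\<in>\<B>. x i \<in> V \<and> V \<subseteq> ball (x i) (e / 2)"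
      proof
        fix i
        have "x i \<in> ball (x i) (e / 2)" using e0 by simp
        from topological_basisE[OF \<B>(2) open_ball this]
        obtain V where "V \<in> \<B>" "x i \<in> V" "V \<subseteq> ball (x i) (e / 2)" .
        then show "\<exists>V\<in>\<B>. x i \<in> V \<and> V \<subseteq> ball (x i) (e / 2)" by (intro bexI conjI)
      qed
      then obtain V' where V': "\<And>i. V' i \<in> \<B>" "\<And>i. x i \<in> V' i" "\<And>i. V' i \<subseteq> ball (x i) (e / 2)"
        by metis
      define V where "V = restrict V' {..m}"
      have V: "V \<in> {..m} \<rightarrow>\<^sub>E \<B>" using V' by (auto simp: V_def)
      have "disjoint_family_on (?V V k) {..m}"
        unfolding disjoint_family_on_def
      proof (intro ballI impI)
        fix i j assume ij: "i \<in> {..m}" "j \<in> {..m}" "i \<noteq> j"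
        have ne: "x j \<noteq> x i" using inj ij by (auto simp: inj_on_def)
        have "e \<le> dist (x i) (x j)" using e[of i "x j"] ij ne x k by auto
        then have "ball (x i) (e/2) \<inter> ball (x j) (e/2) = {}"
          by (intro disjoint_ballI) simp
        then show "?V V k i \<inter> ?V V k j = {}" using V'(3)[of i] V'(3)[of j] ij by (auto simp: V_def)
      qed
      then obtain i where i: "i \<le> m" "eta \<omega> \<inter> ?V V k i \<noteq> {x i}" using elim(2) V x(1) by blast
      moreover have "eta \<omega> \<inter> (V' i \<inter> K k) = {x i}"
      proof (intro equalityI subsetI)
        fix y assume y: "y \<in> eta \<omega> \<inter> (V' i \<inter> K k)"
        then have "dist (x i) y < e / 2" using V'(3)[of i] by auto
        then show "y \<in> {x i}" using e[of i y] e0 i y by force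
      qed (use V' k x i in auto)
      ultimately show False by (simp add: V_def)
    qed
  qed
qed

section \<open>General position\<close>

lemma mem_span_image_lessThan_iff:
  fixes g :: "nat \<Rightarrow> 'a::real_vector"
  shows "y \<in> span (g ` {..<m}) \<longleftrightarrow> (\<exists>a. y = (\<Sum>k<m. a k *\<^sub>R g k))"
proof (induction m arbitrary: y)
  case (Suc m)
  have "y \<in> span (g ` {..<Suc m}) \<longleftrightarrow> (\<exists>k. y - k *\<^sub>R g m \<in> span (g ` {..<m}))"
    by (simp add: lessThan_Suc span_breakdown_eq)
  also have "\<dots> \<longleftrightarrow> (\<exists>k a. y = (\<Sum>i<m. a i *\<^sub>R g i) + k *\<^sub>R g m)"
    by (simp add: Suc.IH diff_eq_eq)
  also have "\<dots> \<longleftrightarrow> (\<exists>a. y = (\<Sum>i<Suc m. a i *\<^sub>R g i))"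
  proof (intro iffI; elim exE)
    fix k a assume "y = (\<Sum>i<m. a i *\<^sub>R g i) + k *\<^sub>R g m"
    then have "y = (\<Sum>i<Suc m. (a(m := k)) i *\<^sub>R g i)" by simp
    then show "\<exists>a. y = (\<Sum>i<Suc m. a i *\<^sub>R g i)" by blast
  qed auto
  finally show ?case .
qed simp

text \<open>A span is closed and rational combinations are dense in it, so membership becomes a
  countable combination of strict norm inequalities, each of them measurable in the
  generators.\<close>

lemma mem_span_iff_rational_approx:
  fixes g :: "nat \<Rightarrow> 'a::euclidean_space"
  shows "y \<in> span (g ` {..<m}) \<longleftrightarrow>
    (\<forall>n::nat. \<exists>c\<in>{..<m} \<rightarrow>\<^sub>E \<rat>. norm (y - (\<Sum>k<m. c k *\<^sub>R g k)) < 1 / (real n + 1))"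
proof
  assume "y \<in> span (g ` {..<m})"
  then obtain a where a: "y = (\<Sum>k<m. a k *\<^sub>R g k)" by (auto simp: mem_span_image_lessThan_iff)
  show "\<forall>n::nat. \<exists>c\<in>{..<m} \<rightarrow>\<^sub>E \<rat>. norm (y - (\<Sum>k<m. c k *\<^sub>R g k)) < 1 / (real n + 1)"
  proof
    fix n :: nat
    define G where "G = (\<Sum>k<m. norm (g k))"
    have G: "G \<ge> 0" by (auto simp: G_def intro: sum_nonneg)
    \<comment> \<open>Coefficient errors below \<open>d\<close> add up to at most
      \<open>d * G\<close>, which is less than \<open>1 / (real n + 1)\<close>. The summand 1 keeps
      the denominator positive.\<close>
    define d where "d = 1 / (real n + 1) / (G + 1)"
    have d: "d > 0" using G by (simp add: d_def)
    have "\<forall>k. \<exists>q\<in>\<rat>. \<bar>a k - q\<bar> < d"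
    proof
      fix k
      obtain q where "q \<in> \<rat>" "a k - d < q" "q < a k" using Rats_dense_in_real[of "a k - d" "a k"] d by auto
      then show "\<exists>q\<in>\<rat>. \<bar>a k - q\<bar> < d" by (intro bexI[of _ q]) auto
    qed
    then obtain c where c: "\<And>k. c k \<in> \<rat>" "\<And>k. \<bar>a k - c k\<bar> < d" by metis
    have "y - (\<Sum>k<m. restrict c {..<m} k *\<^sub>R g k) = (\<Sum>k<m. (a k - c k) *\<^sub>R g k)"
      by (simp add: a scaleR_diff_left sum_subtractf)
    also have "norm \<dots> \<le> (\<Sum>k<m. d * norm (g k))"
      by (rule order_trans[OF norm_sum]) (use c(2) in \<open>auto intro!: sum_mono mult_right_mono intro: less_imp_le\<close>)
    also have "\<dots> = d * G" by (simp add: G_def sum_distrib_left)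
    also have "\<dots> < d * (G + 1)" using d by simp
    also have "\<dots> = 1 / (real n + 1)" using G by (simp add: d_def)
    finally show "\<exists>c\<in>{..<m} \<rightarrow>\<^sub>E \<rat>. norm (y - (\<Sum>k<m. c k *\<^sub>R g k)) < 1 / (real n + 1)"
      using c(1) by (intro bexI[of _ "restrict c {..<m}"]) auto
  qed
next
  assume approx: "\<forall>n::nat. \<exists>c\<in>{..<m} \<rightarrow>\<^sub>E \<rat>. norm (y - (\<Sum>k<m. c k *\<^sub>R g k)) < 1 / (real n + 1)"
  have "y \<in> closure (span (g ` {..<m}))"
    unfolding closure_approachable
  proof (intro allI impI)
    fix e :: real assume "e > 0"
    then obtain n where n: "1 / (real n + 1) < e"
      using reals_Archimedean[of e] by (auto simp: inverse_eq_divide add.commute)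
    obtain c where "norm (y - (\<Sum>k<m. c k *\<^sub>R g k)) < 1 / (real n + 1)" using approx by blast
    moreover have "(\<Sum>k<m. c k *\<^sub>R g k) \<in> span (g ` {..<m})"
      by (auto simp: mem_span_image_lessThan_iff)
    ultimately show "\<exists>z\<in>span (g ` {..<m}). dist z y < e"
      using n by (intro bexI[of _ "\<Sum>k<m. c k *\<^sub>R g k"]) (auto simp: dist_norm norm_minus_commute)
  qed
  then show "y \<in> span (g ` {..<m})" by (simp add: closed_span closure_closed)
qed

lemma continuous_on_lift: "continuous_on S lift"
  unfolding lift_def by (intro continuous_intros)

lemma measurable_lift [measurable]: "lift \<in> borel_measurable borel"
  by (intro borel_measurable_continuous_onI continuous_on_lift)

lemma sets_lift_mem_span:
  fixes m :: nat
  shows "{x \<in> space (PiM {..m} (\<lambda>_. borel)). lift (x m) \<in> span (lift ` x ` {..<m})}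
    \<in> sets (PiM {..m} (\<lambda>_. borel :: ('v::euclidean_space \<times> real) measure))"
proof -
  let ?P = "PiM {..m} (\<lambda>_. borel :: ('v \<times> real) measure)"
  let ?E = "\<lambda>n c. {x \<in> space ?P. norm (lift (x m) - (\<Sum>k<m. c k *\<^sub>R lift (x k))) < 1 / (real n + 1)}"
  have E: "?E n c \<in> sets ?P" for n :: nat and c
  proof -
    have comp: "(\<lambda>x. lift (x k)) \<in> borel_measurable ?P" if "k \<le> m" for k
      by (rule measurable_compose[OF _ measurable_lift]) (use that in \<open>simp add: measurable_component_singleton\<close>)
    have "(\<lambda>x. lift (x m) - (\<Sum>k<m. c k *\<^sub>R lift (x k))) \<in> borel_measurable ?P"
      by (intro borel_measurable_diff borel_measurable_sum borel_measurable_scaleR)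
         (auto intro!: comp)
    then show ?thesis by measurable
  qed
  have "{x \<in> space ?P. lift (x m) \<in> span (lift ` x ` {..<m})} =
      (\<Inter>n. \<Union>c\<in>{..<m} \<rightarrow>\<^sub>E \<rat>. ?E n c)"
    unfolding image_image mem_span_iff_rational_approx set_eq_iff mem_Collect_eq INT_iff UN_iff by blast
  moreover have "(\<Union>c\<in>{..<m} \<rightarrow>\<^sub>E \<rat>. ?E n c) \<in> sets ?P" for n :: nat
    by (rule sets.countable_UN''[OF countable_PiE[OF finite_lessThan countable_rat]]) (rule E)
  ultimately show ?thesis by (simp only:) (intro sets.countable_INT; blast)
qed

text \<open>If the last coefficient \<open>b\<close> is nonzero, the height is a function of the
  position and vertical sections are single points. Otherwise every horizontal section is the
  solution set of \<open>u \<bullet> v = - a\<close>, a hyperplane or, for \<open>u = 0\<close>,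
  empty.\<close>

lemma null_sets_lift_hyperplane:
  fixes z :: "real \<times> 'v::euclidean_space \<times> real"
  assumes "z \<noteq> 0"
  shows "{p. z \<bullet> lift p = 0} \<in> null_sets lborel"
proof -
  obtain a u b where z: "z = (a, u, b)" by (metis surj_pair)
  let ?Z = "{p :: 'v \<times> real. z \<bullet> lift p = 0}"
  have Z: "?Z \<in> sets borel" by measurable
  then have Z': "?Z \<in> sets (lborel \<Otimes>\<^sub>M lborel)" unfolding lborel_prod by simp
  have "emeasure (lborel \<Otimes>\<^sub>M lborel) ?Z = 0"
  proof (cases "b = 0")
    case False
    have "Pair v -` ?Z = {- (a + u \<bullet> v) / b - (norm v)\<^sup>2}" for v
      using False by (auto simp: z lift_def field_simps)
    then show ?thesis
      by (simp add: lborel.emeasure_pair_measure_alt[OF Z'])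
  next
    case True
    have "emeasure lborel ((\<lambda>v. (v, h)) -` ?Z) = 0" for h
    proof (cases "u = 0")
      case True
      then have "(\<lambda>v. (v, h)) -` ?Z = {}" using assms \<open>b = 0\<close> by (auto simp: z lift_def zero_prod_def)
      then show ?thesis by simp
    next
      case False
      have "(\<lambda>v. (v, h)) -` ?Z = {v. u \<bullet> v = - a}" using \<open>b = 0\<close> by (auto simp: z lift_def)
      moreover have "{v. u \<bullet> v = - a} \<in> null_sets lborel"
        using negligible_hyperplane[of u "- a"] False closed_hyperplane[of u "- a"]
        by (simp add: negligible_iff_null_sets null_sets_completion_iff borel_closed)
      ultimately show ?thesis by auto
    qed
    then show ?thesis
      by (simp add: lborel_pair.emeasure_pair_measure_alt2[OF Z'])
  qed
  then show ?thesis using Z by (auto simp: lborel_prod)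
qed

lemma sets_intensity [simp]: "sets (intensity \<gamma> f) = sets borel"
  by (simp add: intensity_def)

lemma measurable_fst_borel [measurable]:
  "fst \<in> measurable (borel :: ('a::topological_space \<times> 'b::topological_space) measure) borel"
  by (rule borel_measurable_continuous_onI[OF continuous_on_fst[OF continuous_on_id]])

lemma measurable_snd_borel [measurable]:
  "snd \<in> measurable (borel :: ('a::topological_space \<times> 'b::topological_space) measure) borel"
  by (rule borel_measurable_continuous_onI[OF continuous_on_snd[OF continuous_on_id]])

lemma null_sets_intensity:
  assumes "f \<in> borel_measurable lborel" "Z \<in> null_sets lborel"
  shows "Z \<in> null_sets (intensity \<gamma> f)"
proof -
  have [measurable]: "f \<in> borel_measurable borel" using assms by simp
  have "AE x in lborel. x \<notin> Z" using assms(2) by (rule AE_not_in)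
  then show ?thesis
    unfolding intensity_def using assms(2)
    by (subst null_sets_density_iff) (auto simp: null_setsD2 elim: AE_mp)
qed

text \<open>In a dependent set one lifted site lies in the span of at most \<open>d + 1\<close>
  others. That span lies in a hyperplane of the \<open>(d + 2)\<close>-dimensional lifted space, so,
  with the others fixed, the site is confined to a null set.\<close>

lemma AE_general_position:
  fixes eta :: "'a \<Rightarrow> ((real^'d) \<times> real) set" and f :: "real \<Rightarrow> real"
  assumes P: "poisson_process M eta (intensity \<gamma> f)"
    and f: "f \<in> borel_measurable lborel" "\<And>h. 0 \<le> f h"
    and \<gamma>: "\<gamma> > 0"
  shows "AE \<omega> in M. \<forall>S\<subseteq>eta \<omega>. finite S \<longrightarrow> card S \<le> DIM(real^'d) + 2 \<longrightarrow> independent (lift ` S)"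
proof -
  let ?L = "intensity \<gamma> f :: ((real^'d) \<times> real) measure"
  have [measurable]: "f \<in> borel_measurable borel" using f by simp
  \<comment> \<open>Bounding \<open>f\<close> together with both coordinates gives a bounded density
    on a bounded set, hence finite intensity.\<close>
  define K where "K k = {p :: (real^'d) \<times> real. norm (fst p) \<le> real k \<and> \<bar>snd p\<bar> \<le> real k \<and> f (snd p) \<le> real k}"
    for k :: nat
  define D where "D m = {x \<in> space (PiM {..m} (\<lambda>_. borel)). lift (x m :: (real^'d) \<times> real) \<in> span (lift ` x ` {..<m})}"
    for m :: nat
  have Kb[measurable]: "K k \<in> sets borel" for k unfolding K_def by measurable
  have "incseq K" unfolding K_def incseq_def by (auto intro: order_trans)
  moreover have "K k \<in> sets ?L" for k using Kb by simp
  moreover have "emeasure ?L (K k) < \<infinity>" for k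
  proof -
    have "emeasure ?L (K k) = (\<integral>\<^sup>+p. ennreal (\<gamma> * f (snd p)) * indicator (K k) p \<partial>lborel)"
      unfolding intensity_def by (subst emeasure_density) auto
    also have "\<dots> \<le> (\<integral>\<^sup>+p. ennreal (\<gamma> * real k) * indicator (cball (0::real^'d) (real k) \<times> cball (0::real) (real k)) p \<partial>lborel)"
      by (rule nn_integral_mono) (use \<gamma> in \<open>auto simp: K_def indicator_def intro!: ennreal_leI mult_left_mono\<close>)
    also have "\<dots> = ennreal (\<gamma> * real k) * emeasure lborel (cball (0::real^'d) (real k) \<times> cball (0::real) (real k))"
      by (intro nn_integral_cmult_indicator) (simp add: closed_Times borel_closed)
    also have "\<dots> < \<infinity>"
      using emeasure_bounded_finite[OF bounded_Times[OF bounded_cball bounded_cball]]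
      by (auto simp: ennreal_mult_less_top)
    finally show ?thesis .
  qed
  moreover have "(\<Union>k. K k) = UNIV"
  proof -
    have "\<exists>k. p \<in> K k" for p
    proof -
      obtain k :: nat where "max (norm (fst p)) (max \<bar>snd p\<bar> (f (snd p))) \<le> real k" using real_arch_simple by blast
      then show ?thesis by (auto simp: K_def)
    qed
    then show ?thesis by auto
  qed
  moreover have "D m \<in> sets (PiM {..m} (\<lambda>_. borel))" for m
    unfolding D_def by (rule sets_lift_mem_span)
  moreover have "{y. x(m := y) \<in> D m} \<in> null_sets ?L"
    if m: "m \<le> DIM(real^'d) + 1" and x: "x \<in> {..<m} \<rightarrow>\<^sub>E UNIV" for x m
  proof -
    have "{y. x(m := y) \<in> D m} = {y. lift y \<in> span (lift ` x ` {..<m})}"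
    proof -
      have "(x(m := y)) ` {..<m} = x ` {..<m}" for y by auto
      moreover have "x(m := y) \<in> space (PiM {..m} (\<lambda>_. borel))" for y
        using x by (auto simp: space_PiM PiE_iff extensional_def)
      ultimately show ?thesis by (auto simp: D_def)
    qed
    moreover have "{y. lift y \<in> span (lift ` x ` {..<m})} \<in> null_sets lborel"
    proof -
      have "dim (lift ` x ` {..<m}) \<le> card (lift ` x ` {..<m})" by (rule dim_le_card') simp
      also have "\<dots> \<le> m" by (metis card_image_le card_lessThan finite_imageI finite_lessThan order_trans)
      also have "\<dots> < DIM(real \<times> (real^'d) \<times> real)" using m by simp
      finally obtain z where z: "z \<noteq> 0" "span (lift ` x ` {..<m}) \<subseteq> {y. z \<bullet> y = 0}"
        using lowdim_subset_hyperplane by blast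
      have "lift -` span (lift ` x ` {..<m}) \<in> sets borel"
        by (intro borel_closed closed_vimage closed_span) (rule continuous_on_lift)
      then show ?thesis
        using z(2) by (intro null_sets_subset[OF null_sets_lift_hyperplane[OF z(1)]]) (auto simp: vimage_def)
    qed
    ultimately show ?thesis using null_sets_intensity[OF f(1)] by simp
  qed
  ultimately have "AE \<omega> in M. \<forall>x\<in>D m. (\<forall>i\<le>m. x i \<in> eta \<omega>) \<longrightarrow> \<not> inj_on x {..m}"
    if "m \<le> DIM(real^'d) + 1" for m
    using that by (intro poisson_AE_no_null_configuration[OF P sets_intensity, of K]) auto
  then have "AE \<omega> in M. \<forall>m\<in>{..DIM(real^'d) + 1}. \<forall>x\<in>D m. (\<forall>i\<le>m. x i \<in> eta \<omega>) \<longrightarrow> \<not> inj_on x {..m}"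
    by (subst AE_ball_countable) auto
  then show ?thesis
  proof eventually_elim
    case (elim \<omega>)
    show ?case
    proof (intro allI impI notI)
      fix S assume S: "S \<subseteq> eta \<omega>" "finite S" "card S \<le> DIM(real^'d) + 2" and "dependent (lift ` S)"
      then obtain p where p: "p \<in> S" "lift p \<in> span (lift ` S - {lift p})"
        unfolding dependent_def by blast
      have eq: "lift ` S - {lift p} = lift ` (S - {p})" using inj_lift by (auto dest: injD)
      define m where "m = card (S - {p})"
      have m: "m \<le> DIM(real^'d) + 1" using S p by (simp add: m_def)
      obtain g where g: "bij_betw g {..<m} (S - {p})"
        using ex_bij_betw_nat_finite[of "S - {p}"] S(2) by (auto simp: m_def atLeast0LessThan)
      \<comment> \<open>The site \<open>p\<close> is placed at the last index \<open>m\<close>,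
        after an enumeration of the others, to match the form of \<open>D m\<close>.\<close>
      define x where "x = restrict (g(m := p)) {..m}"
      have xg: "x i = g i" if "i < m" for i using that by (simp add: x_def)
      have xm: "x m = p" by (simp add: x_def)
      have img: "x ` {..<m} = S - {p}" using g xg by (auto simp: bij_betw_def image_iff)
      have "x \<in> D m"
      proof -
        have "x \<in> space (PiM {..m} (\<lambda>_. borel))" by (simp add: x_def space_PiM)
        then show ?thesis using p(2) by (simp add: D_def img xm eq)
      qed
      moreover have "x i \<in> eta \<omega>" if "i \<le> m" for i
      proof (cases "i = m")
        case False
        then have "x i \<in> x ` {..<m}" using that by simp
        then show ?thesis using S(1) unfolding img by blast
      qed (use xm p S in blast)
      moreover have "inj_on x {..m}"
      proof -
        have "inj_on x {..<m}" using g inj_on_cong[of "{..<m}" x g] xg by (simp add: bij_betw_def)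
        then have "inj_on x (insert m {..<m})" using img xm by (simp add: inj_on_insert)
        moreover have "insert m {..<m} = {..m}" by auto
        ultimately show ?thesis by simp
      qed
      ultimately show False using elim[THEN bspec, of m] m unfolding atMost_iff by blast
    qed
  qed
qed

section \<open>Sites with small power\<close>

lemma emeasure_intensity:
  fixes S :: "((real^'d) \<times> real) set"
  assumes f: "f \<in> borel_measurable lborel" and S: "S \<in> sets borel"
  shows "emeasure (intensity \<gamma> f) S =
    (\<integral>\<^sup>+h. ennreal (\<gamma> * f h) * emeasure lborel {v. (v, h) \<in> S} \<partial>lborel)"
proof -
  have [measurable]: "f \<in> borel_measurable borel" using f by simp
  note [measurable] = S
  have "emeasure (intensity \<gamma> f) S = (\<integral>\<^sup>+p. ennreal (\<gamma> * f (snd p)) * indicator S p \<partial>lborel)"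
    unfolding intensity_def by (subst emeasure_density) auto
  also have "\<dots> = (\<integral>\<^sup>+h. \<integral>\<^sup>+v. ennreal (\<gamma> * f h) * indicator S (v, h) \<partial>lborel \<partial>lborel)"
    by (subst lborel_prod[symmetric], subst lborel_pair.nn_integral_snd[symmetric])
       (simp_all add: lborel_prod)
  also have "\<dots> = (\<integral>\<^sup>+h. ennreal (\<gamma> * f h) * emeasure lborel {v. (v, h) \<in> S} \<partial>lborel)"
  proof (rule nn_integral_cong)
    fix h
    have "{v. (v, h) \<in> S} = (\<lambda>v. (v, h)) -` S \<inter> space lborel" by auto
    also have "\<dots> \<in> sets lborel"
      by (rule measurable_sets[OF _ S]) (simp add: borel_measurable_continuous_onI continuous_on_Pair)
    finally have m: "{v. (v, h) \<in> S} \<in> sets lborel" .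
    have "(\<integral>\<^sup>+v. ennreal (\<gamma> * f h) * indicator S (v, h) \<partial>lborel) =
        (\<integral>\<^sup>+v. ennreal (\<gamma> * f h) * indicator {v. (v, h) \<in> S} v \<partial>lborel)"
      by (rule nn_integral_cong) (auto simp: indicator_def)
    also have "\<dots> = ennreal (\<gamma> * f h) * emeasure lborel {v. (v, h) \<in> S}"
      by (rule nn_integral_cmult_indicator[OF m])
    finally show "(\<integral>\<^sup>+v. ennreal (\<gamma> * f h) * indicator S (v, h) \<partial>lborel) =
      ennreal (\<gamma> * f h) * emeasure lborel {v. (v, h) \<in> S}" .
  qed
  finally show ?thesis .
qed

text \<open>If \<open>T\<close> is the set of positive coordinates of \<open>w\<close>, every
  \<open>v\<close> in the orthant has \<open>w \<bullet> v\<close> at least \<open>N\<close> times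
  the 1-norm of \<open>w\<close>. One site in each of these finitely many orthants therefore handles
  all \<open>w\<close> in \<open>spread\<close>.\<close>

definition far_orthant :: "'d::finite set \<Rightarrow> nat \<Rightarrow> (real^'d) set" where
  "far_orthant T N = {v. \<forall>i. if i \<in> T then real N < v $ i else v $ i < - real N}"

lemma open_far_orthant: "open (far_orthant T N)"
proof -
  have "far_orthant T N = (\<Inter>i\<in>T. {v. real N < v $ i}) \<inter> (\<Inter>i\<in>-T. {v. v $ i < - real N})"
    by (auto simp: far_orthant_def split: if_splits)
  also have "open \<dots>"
    by (intro open_Int open_INT ballI open_Collect_less continuous_intros) auto
  finally show ?thesis .
qed

lemma emeasure_far_orthant: "emeasure lborel (far_orthant T N :: (real^'d) set) = \<infinity>"
proof -
  have "ennreal (real k) \<le> emeasure lborel (far_orthant T N)" for k :: nat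
  proof -
    let ?l = "\<chi> i::'d. if i \<in> T then real N else - real N - real k"
    let ?u = "\<chi> i::'d. if i \<in> T then real N + real k else - real N"
    have ul: "(?u - ?l) \<bullet> b = real k" if "b \<in> Basis" for b
      using that by (auto simp: Basis_vec_def inner_axis)
    have le: "?l \<bullet> b \<le> ?u \<bullet> b" if "b \<in> Basis" for b
      using ul[OF that] by (simp add: inner_diff_left)
    \<comment> \<open>The orthant contains a cube of side \<open>k\<close>, whose volume is at least
      \<open>k\<close> because the dimension is positive.\<close>
    have "real k \<le> real k ^ CARD('d)"
      by (cases k) (auto intro: self_le_power)
    then have "ennreal (real k) \<le> ennreal (\<Prod>b\<in>(Basis::(real^'d) set). (?u - ?l) \<bullet> b)"
      using ul by (intro ennreal_leI) simp
    also have "\<dots> = emeasure lborel (box ?l ?u)"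
      using emeasure_lborel_box[OF le] by simp
    also have "\<dots> \<le> emeasure lborel (far_orthant T N)"
      by (rule emeasure_mono)
         (auto simp: far_orthant_def mem_box_cart borel_open[OF open_far_orthant, unfolded far_orthant_def] split: if_splits)
    finally show ?thesis .
  qed
  then show ?thesis
    by (metis ennreal_top_eq_mult_iff ennreal_of_nat_eq_real_of_nat infinity_ennreal_def
        ennreal_Ex_less_of_nat linorder_not_less top.not_eq_extremum)
qed

text \<open>A far orthant has infinite volume and \<open>f\<close> has positive integral, so the
  orthant carries infinite intensity and almost surely contains the position of a site.\<close>

lemma AE_spread:
  fixes eta :: "'a \<Rightarrow> ((real^'d) \<times> real) set" and f :: "real \<Rightarrow> real"
  assumes P: "poisson_process M eta (intensity \<gamma> f)"
    and f: "f \<in> borel_measurable lborel"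
    and pos: "emeasure lborel {h. f h > 0} > 0"
    and \<gamma>: "\<gamma> > 0"
  shows "AE \<omega> in M. \<forall>c. \<exists>Q\<subseteq>eta \<omega>. finite Q \<and> (\<forall>w. \<exists>q\<in>Q. c * norm w \<le> w \<bullet> fst q)"
proof -
  interpret poisson M eta "intensity \<gamma> f" using P by unfold_locales
  have [measurable]: "f \<in> borel_measurable borel" using f by simp
  have "AE \<omega> in M. eta \<omega> \<inter> (far_orthant T N \<times> UNIV) \<noteq> {}" for T :: "'d set" and N
  proof (rule AE_nonempty)
    have O: "far_orthant T N \<times> (UNIV :: real set) \<in> sets borel"
      by (intro borel_open open_Times open_far_orthant open_UNIV)
    then show "far_orthant T N \<times> UNIV \<in> sets (intensity \<gamma> f)" by simp
    have "emeasure (intensity \<gamma> f) (far_orthant T N \<times> UNIV) =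
        (\<integral>\<^sup>+h. ennreal (\<gamma> * f h) * \<infinity> \<partial>lborel)"
      using emeasure_far_orthant[of T N] by (simp add: emeasure_intensity[OF f O])
    also have "\<dots> = (\<integral>\<^sup>+h. ennreal (\<gamma> * f h) \<partial>lborel) * \<infinity>"
      by (rule nn_integral_multc) measurable
    also have "\<dots> = \<infinity>"
    proof -
      have "{h \<in> space lborel. ennreal (\<gamma> * f h) \<noteq> 0} = {h. f h > 0}"
        using \<gamma> by (auto simp: ennreal_eq_0_iff not_le zero_less_mult_iff)
      then have "(\<integral>\<^sup>+h. ennreal (\<gamma> * f h) \<partial>lborel) \<noteq> 0"
        using pos by (subst nn_integral_0_iff) auto
      then show ?thesis by (simp add: ennreal_mult_top)
    qed
    finally show "emeasure (intensity \<gamma> f) (far_orthant T N \<times> UNIV) = \<infinity>" .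
  qed
  then have "AE \<omega> in M. \<forall>T\<in>(UNIV :: 'd set set). \<forall>N. eta \<omega> \<inter> (far_orthant T N \<times> UNIV) \<noteq> {}"
    by (subst AE_ball_countable) (auto simp: AE_all_countable countable_finite)
  then show ?thesis
  proof eventually_elim
    case (elim \<omega>)
    show ?case
    proof
      fix c :: real
      \<comment> \<open>Natural \<open>N\<close> suffice for all real \<open>c\<close>, which keeps
        the almost sure statement countable.\<close>
      obtain N :: nat where N: "c \<le> real N" using real_arch_simple by blast
      have "\<forall>T. \<exists>q. q \<in> eta \<omega> \<inter> (far_orthant T N \<times> UNIV)" using elim by blast
      then obtain q where q: "\<And>T. q T \<in> eta \<omega> \<inter> (far_orthant T N \<times> UNIV)"
        using choice[of "\<lambda>T q. q \<in> eta \<omega> \<inter> (far_orthant T N \<times> UNIV)"] by blast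
      have "c * norm w \<le> w \<bullet> fst (q {i. w $ i > 0})" for w
      proof -
        let ?v = "fst (q {i. w $ i > 0})"
        have v: "?v \<in> far_orthant {i. w $ i > 0} N" using q[of "{i. w $ i > 0}"] by auto
        have "c * norm w \<le> real N * norm w" using N by (intro mult_right_mono) auto
        also have "\<dots> \<le> real N * (\<Sum>i\<in>UNIV. \<bar>w $ i\<bar>)" by (intro mult_left_mono norm_le_l1_cart) simp
        also have "\<dots> = (\<Sum>i\<in>UNIV. real N * \<bar>w $ i\<bar>)" by (simp add: sum_distrib_left)
        also have "\<dots> \<le> (\<Sum>i\<in>UNIV. w $ i * ?v $ i)"
        proof (rule sum_mono)
          fix i
          show "real N * \<bar>w $ i\<bar> \<le> w $ i * ?v $ i"
          proof (cases "w $ i > 0")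
            case True
            then have "real N \<le> ?v $ i" using v by (auto simp: far_orthant_def dest!: spec[of _ i])
            then show ?thesis using True by (simp add: mult.commute)
          next
            case False
            then have "real N \<le> - ?v $ i" using v by (auto simp: far_orthant_def dest!: spec[of _ i])
            then have "(- w $ i) * real N \<le> (- w $ i) * (- ?v $ i)" using False by (intro mult_left_mono) auto
            then show ?thesis using False by (simp add: mult.commute)
          qed
        qed
        also have "\<dots> = w \<bullet> ?v" by (simp add: inner_vec_def)
        finally show ?thesis .
      qed
      then show "\<exists>Q\<subseteq>eta \<omega>. finite Q \<and> (\<forall>w. \<exists>q\<in>Q. c * norm w \<le> w \<bullet> fst q)"
        using q by (intro exI[of _ "range q"]) auto
    qed
  qed
qed

section \<open>Sites that compete on a ball\<close>

lemma sqrt_power_eq_powr: "x > 0 \<Longrightarrow> sqrt x ^ n = x powr (real n / 2)"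
  by (simp add: powr_half_sqrt[symmetric] powr_realpow[symmetric] powr_powr)

text \<open>The slice at height \<open>h \<le> t\<close> is a ball whose volume is at most a
  constant times \<open>(t' - h) powr (d / 2)\<close>, the kernel of the fractional integral at
  \<open>t'\<close>.\<close>

lemma emeasure_reachable_finite:
  fixes f :: "real \<Rightarrow> real"
  assumes f: "f \<in> borel_measurable lborel" "\<And>h. 0 \<le> f h"
    and RL: "RL_integral (real CARD('d) / 2 + 1) f t' < \<infinity>" and t: "t < t'" and R: "R \<ge> 0"
    and \<gamma>: "\<gamma> > 0"
  shows "emeasure (intensity \<gamma> f)
    {p :: (real^'d) \<times> real. snd p \<le> t \<and> norm (fst p) \<le> R + sqrt (t - snd p)} < \<infinity>"
    (is "emeasure _ ?S < \<infinity>")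
proof -
  have [measurable]: "f \<in> borel_measurable borel" using f by simp
  let ?d = "real CARD('d)"
  \<comment> \<open>Since \<open>t' - h \<ge> t' - t > 0\<close>, the constant \<open>R\<close> is
    at most \<open>R / sqrt (t' - t)\<close> times \<open>sqrt (t' - h)\<close>; the summand 1
    accounts for \<open>sqrt (t - h)\<close>.\<close>
  define c where "c = R / sqrt (t' - t) + 1"
  have c: "c \<ge> 1" using R t by (simp add: c_def)
  define C where "C = \<gamma> * unit_ball_vol ?d * c ^ CARD('d) * Gamma (?d / 2 + 1)"
  have Gam: "Gamma (?d / 2 + 1) > 0" by (intro Gamma_real_pos) simp
  have S: "?S \<in> sets borel" by measurable
  have pw: "ennreal (\<gamma> * f h) * emeasure lborel {v. (v, h) \<in> ?S} \<le>
      ennreal C * (ennreal (f h * (t' - h) powr (?d / 2 + 1 - 1) / Gamma (?d / 2 + 1)) * indicator {..<t'} h)" for h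
  proof (cases "h \<le> t")
    case True
    have "R + sqrt (t - h) \<le> c * sqrt (t' - h)"
    proof -
      have "R = R / sqrt (t' - t) * sqrt (t' - t)" using t by simp
      also have "\<dots> \<le> R / sqrt (t' - t) * sqrt (t' - h)" using R t True by (intro mult_left_mono) auto
      finally have "R \<le> R / sqrt (t' - t) * sqrt (t' - h)" .
      moreover have "sqrt (t - h) \<le> sqrt (t' - h)" using t by simp
      ultimately show ?thesis unfolding c_def distrib_right by linarith
    qed
    then have "(R + sqrt (t - h)) ^ CARD('d) \<le> (c * sqrt (t' - h)) ^ CARD('d)"
      using R True by (intro power_mono) auto
    also have "\<dots> = c ^ CARD('d) * (t' - h) powr (?d / 2)"
      using True t by (simp add: power_mult_distrib sqrt_power_eq_powr)
    finally have vol: "(R + sqrt (t - h)) ^ CARD('d) \<le> c ^ CARD('d) * (t' - h) powr (?d / 2)" .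
    have "{v. (v, h) \<in> ?S} = cball 0 (R + sqrt (t - h))" using True by auto
    then have "ennreal (\<gamma> * f h) * emeasure lborel {v. (v, h) \<in> ?S} =
        ennreal (\<gamma> * f h * (unit_ball_vol ?d * (R + sqrt (t - h)) ^ CARD('d)))"
      using R True \<gamma> f(2)[of h] by (simp add: emeasure_cball ennreal_mult)
    also have "\<dots> \<le> ennreal (\<gamma> * f h * (unit_ball_vol ?d * (c ^ CARD('d) * (t' - h) powr (?d / 2))))"
      using \<gamma> f(2)[of h] vol by (intro ennreal_leI mult_left_mono) auto
    also have "\<gamma> * f h * (unit_ball_vol ?d * (c ^ CARD('d) * (t' - h) powr (?d / 2))) =
        C * (f h * (t' - h) powr (?d / 2 + 1 - 1) / Gamma (?d / 2 + 1))"
      using less_imp_neq[OF Gam] by (simp add: C_def)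
    also have "ennreal \<dots> = ennreal C * (ennreal (f h * (t' - h) powr (?d / 2 + 1 - 1) / Gamma (?d / 2 + 1)) * indicator {..<t'} h)"
    proof -
      have "C \<ge> 0" using \<gamma> c Gam by (simp add: C_def)
      moreover have "f h * (t' - h) powr (?d / 2 + 1 - 1) / Gamma (?d / 2 + 1) \<ge> 0"
        using f(2)[of h] Gam by simp
      ultimately have "ennreal (C * (f h * (t' - h) powr (?d / 2 + 1 - 1) / Gamma (?d / 2 + 1))) =
          ennreal C * ennreal (f h * (t' - h) powr (?d / 2 + 1 - 1) / Gamma (?d / 2 + 1))"
        by (rule ennreal_mult)
      then show ?thesis using True t by (simp del: times_divide_eq_right)
    qed
    finally show ?thesis .
  next
    case False
    then have empty: "{v. (v, h) \<in> ?S} = {}" by auto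
    show ?thesis unfolding empty by simp
  qed
  have "emeasure (intensity \<gamma> f) ?S \<le>
     (\<integral>\<^sup>+h. ennreal C * (ennreal (f h * (t' - h) powr (?d / 2 + 1 - 1) / Gamma (?d / 2 + 1)) * indicator {..<t'} h) \<partial>lborel)"
    unfolding emeasure_intensity[OF f(1) S] by (rule nn_integral_mono) (rule pw)
  also have "\<dots> = ennreal C * RL_integral (?d / 2 + 1) f t'"
    unfolding RL_integral_def by (rule nn_integral_cmult) measurable
  also have "\<dots> < \<infinity>" using RL by (simp add: ennreal_mult_less_top)
  finally show ?thesis .
qed

lemma reachable_of_pow_le:
  assumes "w \<in> cball 0 R" "pow w p \<le> t"
  shows "snd p \<le> t \<and> norm (fst p) \<le> R + sqrt (t - snd p)"
proof -
  have le: "(norm (w - fst p))\<^sup>2 \<le> t - snd p" using assms by (simp add: pow_def)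
  then have "norm (w - fst p) \<le> sqrt (t - snd p)" by (rule real_le_rsqrt)
  moreover have "norm (fst p) \<le> norm w + norm (w - fst p)"
    using norm_triangle_ineq4[of w "w - fst p"] by simp
  moreover have "snd p \<le> t" using le zero_le_power2[of "norm (w - fst p)"] by linarith
  ultimately show ?thesis using assms(1) by simp
qed

text \<open>Sites far below \<open>b\<close> have wide paraboloids, for which \<open>pow_perturb\<close> would fail; up to height
  \<open>b - 2\<close> they contribute only a bounded amount to the integral and can be discarded.\<close>

lemma RL_integral_le_paraboloid:
  fixes f :: "real \<Rightarrow> real" and z :: "real^'d"
  defines "d \<equiv> real CARD('d)"
  assumes f: "f \<in> borel_measurable lborel" "\<And>h. 0 \<le> f h" and \<gamma>: "\<gamma> > 0" and t: "t < b"
  shows "RL_integral (d / 2 + 1) f t \<le>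
    ennreal (2 powr (d / 2)) * RL_integral (d / 2 + 1) f (b - 1) +
    ennreal (1 / (\<gamma> * unit_ball_vol d * Gamma (d / 2 + 1))) *
      emeasure (intensity \<gamma> f) {p. b - 2 \<le> snd p \<and> pow z p \<le> t}"
    (is "_ \<le> _ + ennreal ?K * emeasure _ ?S")
proof -
  have [measurable]: "f \<in> borel_measurable borel" using f by simp
  have Gam: "Gamma (d / 2 + 1) > 0" by (intro Gamma_real_pos) (simp add: d_def)
  have ubv: "unit_ball_vol d > 0" by (simp add: d_def)
  have S: "?S \<in> sets borel" unfolding pow_def by measurable
  let ?g = "\<lambda>s h. ennreal (f h * (s - h) powr (d / 2 + 1 - 1) / Gamma (d / 2 + 1)) * indicator {..<s} h"
  let ?e = "\<lambda>h. ennreal (\<gamma> * f h) * emeasure lborel {v. (v, h) \<in> ?S}"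
  have e: "?e h = ennreal (\<gamma> * f h * (unit_ball_vol d * (t - h) powr (d / 2)))" if h: "b - 2 \<le> h" "h < t" for h
  proof -
    have "{v. (v, h) \<in> ?S} = cball z (sqrt (t - h))"
    proof (intro equalityI subsetI)
      fix v assume "v \<in> {v. (v, h) \<in> ?S}"
      then have "(norm (z - v))\<^sup>2 \<le> t - h" by (simp add: pow_def)
      then show "v \<in> cball z (sqrt (t - h))" by (simp add: dist_norm real_le_rsqrt)
    next
      fix v assume "v \<in> cball z (sqrt (t - h))"
      then have "(norm (z - v))\<^sup>2 \<le> (sqrt (t - h))\<^sup>2" by (intro power_mono) (auto simp: dist_norm)
      then show "v \<in> {v. (v, h) \<in> ?S}" using h by (simp add: pow_def)
    qed
    then show ?thesis
      using h \<gamma> f(2)[of h] ubv by (simp add: emeasure_cball ennreal_mult sqrt_power_eq_powr d_def)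
  qed
  have pw: "?g t h \<le> ennreal (2 powr (d / 2)) * ?g (b - 1) h + ennreal ?K * ?e h" for h
  proof (cases "h < t")
    case True
    show ?thesis
    proof (cases "b - 2 \<le> h")
      case False
      \<comment> \<open>For \<open>h < b - 2\<close> the distance \<open>b - 1 - h\<close> exceeds
        1, so \<open>t - h < b - h\<close> is at most twice that distance.\<close>
      have "(t - h) powr (d / 2) \<le> (2 * (b - 1 - h)) powr (d / 2)"
        using True False t by (intro powr_mono2) (auto simp: d_def)
      also have "\<dots> = 2 powr (d / 2) * (b - 1 - h) powr (d / 2)"
        by (rule powr_mult)
      finally have "f h * (t - h) powr (d / 2) / Gamma (d / 2 + 1) \<le>
          f h * (2 powr (d / 2) * (b - 1 - h) powr (d / 2)) / Gamma (d / 2 + 1)"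
        using f(2)[of h] Gam by (intro divide_right_mono mult_left_mono) auto
      also have "\<dots> = 2 powr (d / 2) * (f h * (b - 1 - h) powr (d / 2) / Gamma (d / 2 + 1))" by simp
      finally have "?g t h \<le> ennreal (2 powr (d / 2) * (f h * (b - 1 - h) powr (d / 2) / Gamma (d / 2 + 1)))"
        using True by (simp add: ennreal_leI)
      also have "\<dots> = ennreal (2 powr (d / 2)) * ?g (b - 1) h"
        using False f(2)[of h] Gam by (subst ennreal_mult) auto
      finally show ?thesis by (rule order_trans) simp
    next
      case bh: True
      have "ennreal ?K * ?e h = ennreal (?K * (\<gamma> * f h * (unit_ball_vol d * (t - h) powr (d / 2))))"
        unfolding e[OF bh True] using \<gamma> ubv Gam f(2)[of h] by (subst ennreal_mult) auto
      also have "?K * (\<gamma> * f h * (unit_ball_vol d * (t - h) powr (d / 2))) =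
          f h * (t - h) powr (d / 2) / Gamma (d / 2 + 1)"
        using \<gamma> ubv Gam by (simp add: field_simps)
      finally show ?thesis using True by simp
    qed
  qed simp
  have [measurable]: "(\<lambda>h. emeasure lborel {v. (v, h) \<in> ?S}) \<in> borel_measurable borel"
  proof -
    have "?S \<in> sets (lborel \<Otimes>\<^sub>M lborel)" using S unfolding lborel_prod by simp
    from lborel_pair.measurable_emeasure_Pair2[OF this] show ?thesis by (simp add: vimage_def)
  qed
  have "RL_integral (d / 2 + 1) f t \<le>
      (\<integral>\<^sup>+h. ennreal (2 powr (d / 2)) * ?g (b - 1) h + ennreal ?K * ?e h \<partial>lborel)"
    unfolding RL_integral_def by (rule nn_integral_mono) (rule pw)
  also have "\<dots> = ennreal (2 powr (d / 2)) * (\<integral>\<^sup>+h. ?g (b - 1) h \<partial>lborel) +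
      ennreal ?K * (\<integral>\<^sup>+h. ?e h \<partial>lborel)"
  proof -
    have g: "?g (b - 1) \<in> borel_measurable lborel" by measurable
    have e: "?e \<in> borel_measurable lborel" by measurable
    have "(\<lambda>h. ennreal (2 powr (d / 2)) * ?g (b - 1) h) \<in> borel_measurable lborel"
      "(\<lambda>h. ennreal ?K * ?e h) \<in> borel_measurable lborel" by measurable
    from nn_integral_add[OF this] show ?thesis
      by (simp only: nn_integral_cmult[OF g] nn_integral_cmult[OF e])
  qed
  finally show ?thesis unfolding RL_integral_def emeasure_intensity[OF f(1) S] .
qed

text \<open>Rounding every coordinate down to a multiple of \<open>1 / m\<close> changes it by at
  most \<open>1 / m\<close>, and the 1-norm bounds the norm. The cardinality is polynomial in
  \<open>m\<close>, which an exponentially small void probability can beat.\<close>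

lemma grid_cover:
  fixes R m :: nat
  assumes m: "m > 0"
  shows "\<exists>Z :: (real^'d) set. finite Z \<and> card Z \<le> (2 * R * m + 1) ^ CARD('d) \<and>
    (\<forall>w\<in>cball 0 (real R). \<exists>z\<in>Z. norm (w - z) \<le> real CARD('d) / real m)"
proof -
  define I where "I = {- int (R * m)..int (R * m)}"
  define G :: "('d \<Rightarrow> int) \<Rightarrow> real^'d" where "G k = (\<chi> i. real_of_int (k i) / real m)" for k
  define K where "K = (UNIV :: 'd set) \<rightarrow>\<^sub>E I"
  have fin: "finite K" unfolding K_def I_def by (intro finite_PiE) auto
  have "card K = card I ^ CARD('d)" unfolding K_def by (subst card_PiE) simp_all
  moreover have "card I = 2 * R * m + 1" unfolding I_def card_atLeastAtMost_int by (simp add: nat_add_distrib nat_mult_distrib flip: of_nat_mult)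
  ultimately have "card (G ` K) \<le> (2 * R * m + 1) ^ CARD('d)" using card_image_le[OF fin, of G] by simp
  moreover have "\<exists>z\<in>G ` K. norm (w - z) \<le> real CARD('d) / real m" if w: "w \<in> cball 0 (real R)" for w
  proof -
    define k where "k i = \<lfloor>real m * w $ i\<rfloor>" for i
    have "k \<in> K"
    proof -
      have "k i \<in> I" for i
      proof -
        have "\<bar>w $ i\<bar> \<le> real R" using component_le_norm_cart[of w i] w by simp
        then have "\<bar>real m * w $ i\<bar> \<le> real m * real R" unfolding abs_mult by (intro mult_mono) auto
        then have "real_of_int (- int (R * m)) \<le> real m * w $ i" "real m * w $ i \<le> real_of_int (int (R * m))"
          by (auto simp: mult.commute abs_le_iff)
        then have "- int (R * m) \<le> k i" "k i \<le> int (R * m)"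
          unfolding k_def by (simp_all add: le_floor_iff floor_le_iff)
        then show ?thesis by (simp add: I_def)
      qed
      then show ?thesis by (simp add: K_def PiE_iff extensional_def)
    qed
    moreover have "norm (w - G k) \<le> real CARD('d) / real m"
    proof -
      have "\<bar>(w - G k) $ i\<bar> \<le> 1 / real m" for i
      proof -
        have "\<bar>real m * w $ i - real_of_int (k i)\<bar> \<le> 1" unfolding k_def by linarith
        moreover have "(w - G k) $ i = (real m * w $ i - real_of_int (k i)) / real m"
          using m by (simp add: G_def diff_divide_distrib)
        ultimately show ?thesis using m by (simp add: divide_right_mono)
      qed
      then have "(\<Sum>i\<in>UNIV. \<bar>(w - G k) $ i\<bar>) \<le> (\<Sum>i\<in>(UNIV::'d set). 1 / real m)" by (intro sum_mono)
      then show ?thesis using norm_le_l1_cart[of "w - G k"] by simp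
    qed
    ultimately show ?thesis by blast
  qed
  ultimately show ?thesis using fin by (intro exI[of _ "G ` K"]) auto
qed

text \<open>The height bound confines the site to distance 2 from \<open>z\<close>, so the power
  changes by at most \<open>5 * norm (w - z)\<close>. The radius \<open>1 / (10 * n)\<close> makes
  this at most \<open>1 / (2 * n)\<close>, half of the available gap.\<close>

lemma pow_perturb:
  fixes w z :: "'v::real_normed_vector"
  assumes n: "n \<ge> (1::real)" and wz: "norm (w - z) \<le> 1 / (10 * n)"
    and p: "b - 2 \<le> snd p" "pow z p \<le> b - 1 / n"
  shows "pow w p \<le> b - 1 / (2 * n)"
proof -
  define a where "a = norm (z - fst p)"
  define e where "e = norm (w - z)"
  have a2: "a\<^sup>2 + snd p \<le> b - 1 / n" using p(2) by (simp add: pow_def a_def)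
  have "1 / n > 0" using n by simp
  then have "a\<^sup>2 \<le> 2\<^sup>2" using a2 p(1) unfolding power2_eq_square[of 2] by linarith
  then have a: "0 \<le> a" "a \<le> 2" by (auto simp: a_def intro: power2_le_imp_le)
  have e: "0 \<le> e" "e \<le> 1 / (10 * n)" using wz by (auto simp: e_def)
  have "1 / (10 * n) \<le> 1" using n by (simp add: field_simps)
  then have e1: "e * e \<le> e" using e mult_left_le[of e e] by simp
  have "norm (w - fst p) \<le> a + e"
    using norm_triangle_ineq[of "w - z" "z - fst p"] by (simp add: a_def e_def)
  then have "(norm (w - fst p))\<^sup>2 \<le> (a + e)\<^sup>2" by (intro power_mono) auto
  also have "\<dots> = a\<^sup>2 + 2 * (a * e) + e * e" by (simp add: power2_eq_square algebra_simps)
  also have "\<dots> \<le> a\<^sup>2 + 5 * e" using mult_right_mono[OF a(2) e(1)] e1 by linarith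
  also have "\<dots> \<le> a\<^sup>2 + 1 / n - 1 / (2 * n)" using e(2) n by (simp add: field_simps)
  finally show ?thesis using a2 by (simp add: pow_def)
qed

text \<open>A union bound over a grid: if each grid point has a site of height at least
  \<open>b - 2\<close> and power at most \<open>b - 1 / n\<close>, then \<open>pow_perturb\<close>
  covers the ball. The probability of failure at level \<open>n\<close> tends to 0, so almost surely
  some level succeeds.\<close>

lemma AE_covered:
  fixes eta :: "'a \<Rightarrow> ((real^'d) \<times> real) set" and f :: "real \<Rightarrow> real" and R n0 :: nat
  assumes P: "poisson_process M eta (intensity \<gamma> f)"
    and f: "f \<in> borel_measurable lborel" "\<And>h. 0 \<le> f h" and \<gamma>: "\<gamma> > 0"
    and fin: "RL_integral (real CARD('d) / 2 + 1) f (b - 1) < \<infinity>"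
    and eps: "\<epsilon> > 0" "\<And>n. n \<ge> n0 \<Longrightarrow>
      ennreal (real n powr \<epsilon>) \<le> RL_integral (real CARD('d) / 2 + 1) f (b - 1 / real n)"
  shows "AE \<omega> in M. \<exists>n\<ge>1. \<forall>w\<in>cball 0 (real R). \<exists>p\<in>eta \<omega>. pow w p \<le> b - 1 / (2 * real n)"
proof -
  interpret poisson M eta "intensity \<gamma> f" using P by unfold_locales
  define D where "D = CARD('d)"
  have D: "D > 0" by (simp add: D_def)
  define K where "K = 1 / (\<gamma> * unit_ball_vol (real D) * Gamma (real D / 2 + 1))"
  have "Gamma (real D / 2 + 1) > 0" by (intro Gamma_real_pos) simp
  then have K: "K > 0" using \<gamma> by (simp add: K_def)
  define C where "C = 2 powr (real D / 2) * enn2real (RL_integral (real D / 2 + 1) f (b - 1))"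
  have C: "C \<ge> 0" by (simp add: C_def)
  have Ceq: "ennreal (2 powr (real D / 2)) * RL_integral (real D / 2 + 1) f (b - 1) = ennreal C"
    using fin by (simp add: C_def D_def ennreal_mult ennreal_enn2real_if)
  define Par where "Par n z = {p :: (real^'d) \<times> real. b - 2 \<le> snd p \<and> pow z p \<le> b - 1 / real n}"
    for n :: nat and z
  have Par: "Par n z \<in> sets (intensity \<gamma> f)" for n z
    unfolding Par_def pow_def sets_intensity by measurable
  \<comment> \<open>Obtained by solving \<open>real n powr \<epsilon> \<le> C + K * r\<close> for
    the intensity \<open>r\<close> of \<open>Par n z\<close>.\<close>
  define L where "L n = (real n powr \<epsilon> - C) / K" for n :: nat
  have void: "prob {\<omega> \<in> space M. eta \<omega> \<inter> Par n z = {}} \<le> exp (- L n)" if n: "n \<ge> n0" "n \<ge> 1" for n z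
  proof (rule prob_void_le[OF Par])
    have "ennreal (real n powr \<epsilon>) \<le> RL_integral (real D / 2 + 1) f (b - 1 / real n)"
      using eps(2) n by (simp add: D_def)
    also have "\<dots> \<le> ennreal C + ennreal K * emeasure (intensity \<gamma> f) (Par n z)"
      using RL_integral_le_paraboloid[OF f \<gamma>, of "b - 1 / real n" b z] n
      unfolding D_def[symmetric] K_def[symmetric] Par_def[symmetric] Ceq by simp
    finally have le: "ennreal (real n powr \<epsilon>) \<le> ennreal C + ennreal K * emeasure (intensity \<gamma> f) (Par n z)" .
    show "ennreal (L n) \<le> emeasure (intensity \<gamma> f) (Par n z)"
    proof (cases "emeasure (intensity \<gamma> f) (Par n z)")
      case (real r)
      then have "ennreal (real n powr \<epsilon>) \<le> ennreal (C + K * r)"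
        using le C K real by (simp add: ennreal_mult)
      then have "real n powr \<epsilon> \<le> C + K * r" by (subst (asm) ennreal_le_iff) (use C K real(1) in auto)
      then have "L n \<le> r" using K by (simp add: L_def field_simps)
      then show ?thesis using real by (simp add: ennreal_leI)
    qed simp
  qed
  have "\<forall>n. \<exists>Z :: (real^'d) set. n \<ge> 1 \<longrightarrow> finite Z \<and> card Z \<le> (2 * R * (10 * n * D) + 1) ^ D \<and>
    (\<forall>w\<in>cball 0 (real R). \<exists>z\<in>Z. norm (w - z) \<le> 1 / (10 * real n))"
  proof
    fix n :: nat
    show "\<exists>Z :: (real^'d) set. n \<ge> 1 \<longrightarrow> finite Z \<and> card Z \<le> (2 * R * (10 * n * D) + 1) ^ D \<and>
      (\<forall>w\<in>cball 0 (real R). \<exists>z\<in>Z. norm (w - z) \<le> 1 / (10 * real n))"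
      \<comment> \<open>The factor \<open>D\<close> in the mesh cancels the dimension in the
        covering radius and leaves the \<open>1 / (10 * n)\<close> required by
        \<open>pow_perturb\<close>.\<close>
      using grid_cover[where 'd='d, of "10 * n * D" R] D
      by (cases "n \<ge> 1") (simp_all add: D_def[symmetric])
  qed
  then obtain Z :: "nat \<Rightarrow> (real^'d) set" where Z: "\<And>n. n \<ge> 1 \<Longrightarrow> finite (Z n)"
      "\<And>n. n \<ge> 1 \<Longrightarrow> card (Z n) \<le> (2 * R * (10 * n * D) + 1) ^ D"
      "\<And>n w. n \<ge> 1 \<Longrightarrow> w \<in> cball 0 (real R) \<Longrightarrow> \<exists>z\<in>Z n. norm (w - z) \<le> 1 / (10 * real n)"
    by metis
  define n1 where "n1 = max n0 1"
  define bad where "bad n = (\<Union>z\<in>Z n. {\<omega> \<in> space M. eta \<omega> \<inter> Par n z = {}})" for n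
  have bad: "bad n \<in> events" if "n \<ge> n1" for n
    unfolding bad_def using Z(1)[of n] that by (intro sets.finite_UN sets_void Par) (auto simp: n1_def)
  define c where "c = 20 * real R * real D + 1"
  have c: "c > 0" by (simp add: c_def add_nonneg_pos)
  have pbad: "prob (bad n) \<le> (c * real n) ^ D * exp (- L n)" if "n \<ge> n1" for n
  proof -
    have n: "n \<ge> n0" "n \<ge> 1" using that by (auto simp: n1_def)
    have "prob (bad n) \<le> (\<Sum>z\<in>Z n. prob {\<omega> \<in> space M. eta \<omega> \<inter> Par n z = {}})"
      unfolding bad_def using Z(1)[OF n(2)] sets_void[OF Par] by (intro finite_measure_subadditive_finite) auto
    also have "\<dots> \<le> (\<Sum>z\<in>Z n. exp (- L n))" by (intro sum_mono void n)
    also have "\<dots> = real (card (Z n)) * exp (- L n)" by simp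
    also have "\<dots> \<le> real ((2 * R * (10 * n * D) + 1) ^ D) * exp (- L n)"
      using Z(2)[OF n(2)] by (intro mult_right_mono) (auto simp del: of_nat_power)
    also have "real ((2 * R * (10 * n * D) + 1) ^ D) \<le> (c * real n) ^ D"
    proof -
      have "real (2 * R * (10 * n * D) + 1) \<le> c * real n" using n(2) by (simp add: c_def algebra_simps)
      then show ?thesis unfolding of_nat_power by (intro power_mono) auto
    qed
    finally show ?thesis by simp
  qed
  \<comment> \<open>A polynomial in \<open>n\<close> times
    \<open>exp (- real n powr \<epsilon> / K)\<close>, up to a constant factor, tends to 0.\<close>
  have "(\<lambda>n. (c * real n) ^ D * exp (- L n)) \<longlonglongrightarrow> 0"
    unfolding L_def using c K eps(1) by real_asymp
  moreover have "prob (\<Inter>n\<in>{n1..}. bad n) \<le> (c * real n) ^ D * exp (- L n)" if "n \<ge> n1" for n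
    using that by (intro order_trans[OF finite_measure_mono pbad] bad) auto
  ultimately have "prob (\<Inter>n\<in>{n1..}. bad n) \<le> 0"
    by (intro LIMSEQ_le_const) auto
  then have "prob (\<Inter>n\<in>{n1..}. bad n) = 0" by (simp add: measure_le_0_iff)
  moreover have "(\<Inter>n\<in>{n1..}. bad n) \<in> events"
    by (rule sets.countable_INT') (auto intro: bad)
  ultimately have "AE \<omega> in M. \<omega> \<notin> (\<Inter>n\<in>{n1..}. bad n)" using prob_eq_0 by blast
  then show ?thesis
  proof (rule AE_mp, intro AE_I2 impI)
    fix \<omega> assume w: "\<omega> \<in> space M" "\<omega> \<notin> (\<Inter>n\<in>{n1..}. bad n)"
    then obtain n where n: "n \<ge> n1" "\<omega> \<notin> bad n" by auto
    then have n1: "n \<ge> 1" by (simp add: n1_def)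
    have "\<exists>p\<in>eta \<omega>. pow w p \<le> b - 1 / (2 * real n)" if "w \<in> cball 0 (real R)" for w
    proof -
      obtain z where z: "z \<in> Z n" "norm (w - z) \<le> 1 / (10 * real n)" using Z(3)[OF n1] \<open>w \<in> cball 0 (real R)\<close> by blast
      then have "eta \<omega> \<inter> Par n z \<noteq> {}" using n(2) w(1) unfolding bad_def by blast
      then obtain p where p: "p \<in> eta \<omega>" "b - 2 \<le> snd p" "pow z p \<le> b - 1 / real n"
        unfolding Par_def by blast
      show ?thesis using pow_perturb[OF _ z(2) p(2,3)] p(1) n1 by auto
    qed
    then show "\<exists>n\<ge>1. \<forall>w\<in>cball 0 (real R). \<exists>p\<in>eta \<omega>. pow w p \<le> b - 1 / (2 * real n)" using n1 by blast
  qed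
qed

lemma AE_finite_reachable:
  fixes eta :: "'a \<Rightarrow> ((real^'d) \<times> real) set" and f :: "real \<Rightarrow> real" and R :: nat
  assumes P: "poisson_process M eta (intensity \<gamma> f)"
    and f: "f \<in> borel_measurable lborel" "\<And>h. 0 \<le> f h" and \<gamma>: "\<gamma> > 0"
    and RL: "RL_integral (real CARD('d) / 2 + 1) f t' < \<infinity>" "t < t'"
  shows "AE \<omega> in M. finite {p \<in> eta \<omega>. \<exists>w\<in>cball 0 (real R). pow w p \<le> t}"
proof -
  interpret poisson M eta "intensity \<gamma> f" using P by unfold_locales
  let ?S = "{p :: (real^'d) \<times> real. snd p \<le> t \<and> norm (fst p) \<le> real R + sqrt (t - snd p)}"
  have "?S \<in> sets (intensity \<gamma> f)" unfolding sets_intensity by measurable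
  then have "AE \<omega> in M. finite (eta \<omega> \<inter> ?S)"
    by (rule AE_finite) (rule emeasure_reachable_finite[OF f RL _ \<gamma>], simp)
  then show ?thesis
  proof eventually_elim
    case (elim \<omega>)
    have "{p \<in> eta \<omega>. \<exists>w\<in>cball 0 (real R). pow w p \<le> t} \<subseteq> eta \<omega> \<inter> ?S"
      using reachable_of_pow_le[of _ "real R" _ t] by blast
    then show ?case using elim by (rule finite_subset)
  qed
qed

text \<open>Almost sure statements are collected over the countably many natural radii; this passes
  to all real radii.\<close>

lemma locally_determined_real_radius:
  assumes "\<And>N::nat. \<exists>t. finite {p \<in> A. \<exists>w\<in>cball 0 (real N). pow w p \<le> t} \<and>
      (\<forall>w\<in>cball 0 (real N). \<exists>p\<in>A. pow w p \<le> t)"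
  shows "\<exists>t. finite {p \<in> A. \<exists>w\<in>cball 0 R. pow w p \<le> t} \<and> (\<forall>w\<in>cball 0 R. \<exists>p\<in>A. pow w p \<le> t)"
proof -
  obtain N :: nat where "R \<le> real N" using real_arch_simple by blast
  then have sub: "cball 0 R \<subseteq> cball (0::'a) (real N)" by auto
  obtain t where t: "finite {p \<in> A. \<exists>w\<in>cball 0 (real N). pow w p \<le> t}"
    "\<forall>w\<in>cball 0 (real N). \<exists>p\<in>A. pow w p \<le> t" using assms by blast
  have "finite {p \<in> A. \<exists>w\<in>cball 0 R. pow w p \<le> t}"
    by (rule finite_subset[OF _ t(1)]) (use sub in blast)
  then show ?thesis using t(2) sub by blast
qed

lemma pow_le_on_cball:
  assumes "w \<in> cball 0 R"
  shows "pow w p \<le> (R + norm (fst p))\<^sup>2 + snd p"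
proof -
  have "norm (w - fst p) \<le> R + norm (fst p)" using assms norm_triangle_ineq4[of w "fst p"] by simp
  then show ?thesis unfolding pow_def by (simp add: power_mono)
qed

theorem mainTheorem3:
  fixes E :: "real set" and f :: "real \<Rightarrow> real" and \<gamma> :: real
    and M :: "'a measure" and eta :: "'a \<Rightarrow> ((real^'d) \<times> real) set"
  assumes E_type: "(\<exists>a. E = {a..}) \<or> (\<exists>b. E = {..<b}) \<or> E = UNIV"
    and f_L1loc: "L1_loc_plus E f"
    and f_nontrivial: "emeasure lborel {h \<in> E. f h > 0} > 0"
    and f_adm: "admissible CARD('d) E f"
    and gamma_pos: "\<gamma> > 0"
    and PPP: "poisson_process M eta (intensity \<gamma> f :: ((real^'d) \<times> real) measure)"
  shows "AE \<omega> in M. normal_tessellation (laguerre_diagram (eta \<omega>))"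
proof -
  have f: "f \<in> borel_measurable lborel" "\<And>h. 0 \<le> f h"
    using f_L1loc by (auto simp: L1_loc_plus_def)
  have [measurable]: "f \<in> borel_measurable borel" using f(1) by simp
  have RL: "RL_integral (real CARD('d) / 2 + 1) f t < \<infinity>" if "t \<in> E" for t
    using f_adm that by (simp add: admissible_def)
  have pos: "emeasure lborel {h. f h > 0} > 0"
    by (rule less_le_trans[OF f_nontrivial emeasure_mono]) auto
  note spread = AE_spread[OF PPP f(1) pos gamma_pos]
  note finite_reachable = AE_finite_reachable[OF PPP f gamma_pos RL]
  have "AE \<omega> in M. \<forall>N::nat. \<exists>t. finite {p \<in> eta \<omega>. \<exists>w\<in>cball 0 (real N). pow w p \<le> t} \<and>
      (\<forall>w\<in>cball 0 (real N). \<exists>p\<in>eta \<omega>. pow w p \<le> t)"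
  proof (cases "\<exists>b. E = {..<b}")
    \<comment> \<open>Here \<open>E\<close> is unbounded above, so every threshold has a larger
      \<open>t'\<close> in \<open>E\<close> and a single site bounds the minimal power on each
      ball.\<close>
    case False
    have "\<exists>t'\<in>E. t < t'" for t
    proof -
      consider a where "E = {a..}" | "E = UNIV" using E_type False by blast
      then show ?thesis
      proof cases
        case (1 a)
        then show ?thesis by (intro bexI[of _ "max a (t + 1)"]) auto
      qed (auto intro: gt_ex)
    qed
    then have "AE \<omega> in M. finite {p \<in> eta \<omega>. \<exists>w\<in>cball 0 (real N). pow w p \<le> real k}" for N k :: nat
      using finite_reachable by blast
    then have "AE \<omega> in M. \<forall>N k. finite {p \<in> eta \<omega>. \<exists>w\<in>cball 0 (real N). pow w p \<le> real k}"
      by (simp add: AE_all_countable)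
    with spread show ?thesis
    proof eventually_elim
      case (elim \<omega>)
      obtain p where p: "p \<in> eta \<omega>" using elim(1) by blast
      show ?case
      proof
        fix N :: nat
        obtain k :: nat where "(real N + norm (fst p))\<^sup>2 + snd p \<le> real k" using real_arch_simple by blast
        then have "\<forall>w\<in>cball 0 (real N). pow w p \<le> real k"
          using pow_le_on_cball[of _ "real N" p] order_trans by blast
        then show "\<exists>t. finite {p \<in> eta \<omega>. \<exists>w\<in>cball 0 (real N). pow w p \<le> t} \<and>
            (\<forall>w\<in>cball 0 (real N). \<exists>p\<in>eta \<omega>. pow w p \<le> t)"
          using elim(2) p by blast
      qed
    qed
  \<comment> \<open>Now only thresholds below \<open>b\<close> are under control, so the minimal
    power on each ball must be kept away from \<open>b\<close>.\<close>
  next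
    case True
    then obtain b where b: "E = {..<b}" by blast
    obtain \<epsilon> n0 where eps: "\<epsilon> > 0" "\<And>n. n \<ge> n0 \<Longrightarrow>
        ennreal (real n powr \<epsilon>) \<le> RL_integral (real CARD('d) / 2 + 1) f (b - 1 / real n)"
      using f_adm b by (auto simp: admissible_def)
    have "AE \<omega> in M. \<exists>n\<ge>1. \<forall>w\<in>cball 0 (real N). \<exists>p\<in>eta \<omega>. pow w p \<le> b - 1 / (2 * real n)" for N :: nat
      by (rule AE_covered[OF PPP f gamma_pos _ eps]) (use RL[of "b - 1"] b in auto)
    then have "AE \<omega> in M. \<forall>N::nat. \<exists>n\<ge>1. \<forall>w\<in>cball 0 (real N). \<exists>p\<in>eta \<omega>. pow w p \<le> b - 1 / (2 * real n)"
      by (simp add: AE_all_countable)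
    moreover have "AE \<omega> in M. finite {p \<in> eta \<omega>. \<exists>w\<in>cball 0 (real N). pow w p \<le> b - 1 / (2 * real n)}"
      if "n \<ge> 1" for N n :: nat
      \<comment> \<open>The point \<open>b - 1 / (4 * n)\<close> lies in \<open>E\<close>, strictly
        between the threshold and \<open>b\<close>.\<close>
      by (rule finite_reachable[of "b - 1 / (4 * real n)"]) (use that b in \<open>auto simp: field_simps\<close>)
    then have "AE \<omega> in M. \<forall>N. \<forall>n\<in>{1..}. finite {p \<in> eta \<omega>. \<exists>w\<in>cball 0 (real N). pow w p \<le> b - 1 / (2 * real n)}"
      by (simp add: AE_all_countable AE_ball_countable)
    ultimately show ?thesis
    proof eventually_elim
      case (elim \<omega>)
      show ?case
      proof
        fix N :: nat
        obtain n where n: "n \<ge> 1" "\<forall>w\<in>cball 0 (real N). \<exists>p\<in>eta \<omega>. pow w p \<le> b - 1 / (2 * real n)"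
          using elim(1) by blast
        then show "\<exists>t. finite {p \<in> eta \<omega>. \<exists>w\<in>cball 0 (real N). pow w p \<le> t} \<and>
            (\<forall>w\<in>cball 0 (real N). \<exists>p\<in>eta \<omega>. pow w p \<le> t)"
          using elim(2) by (intro exI[of _ "b - 1 / (2 * real n)"]) simp
      qed
    qed
  qed
  with spread AE_general_position[OF PPP f gamma_pos] show ?thesis
  proof eventually_elim
    case (elim \<omega>)
    interpret generic_sites "eta \<omega>"
    proof
      fix R c :: real and S
      show "\<exists>t. finite {p \<in> eta \<omega>. \<exists>w\<in>cball 0 R. pow w p \<le> t} \<and>
          (\<forall>w\<in>cball 0 R. \<exists>p\<in>eta \<omega>. pow w p \<le> t)"
        by (rule locally_determined_real_radius) (rule elim(3)[rule_format])
      show "\<exists>Q\<subseteq>eta \<omega>. finite Q \<and> (\<forall>w. \<exists>q\<in>Q. c * norm w \<le> w \<bullet> fst q)" by (rule elim(1)[rule_format])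
      show "S \<subseteq> eta \<omega> \<Longrightarrow> finite S \<Longrightarrow> card S \<le> DIM(real^'d) + 2 \<Longrightarrow> independent (lift ` S)"
        by (rule elim(2)[rule_format])
    qed
    show ?case by (rule normal_tessellation_laguerre_diagram)
  qed
qed

end
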